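(* Let $(k,\{\cdot,\cdot\})$ be a bidifferential field of characteristic zero and let $\phi:X\to Y$ be a dominant $B$-morphism of irreducible $B$-varieties over $k$. Assume $Y$ is $B$-locally-closed. Let $L=k(Y)$ and let $X_\alpha=\phi_L^{-1}(\alpha)$ be the generic $B$-fibre of $\phi$ over $L$, where $k(\alpha)=L$. Then the following are equivalent: (i) $X$ is $B$-locally-closed (as a $B$-variety over $k$). (ii) The generic $B$-fibre $X_\alpha$ of $\phi$ over $k(Y)$ is $B$-locally-closed (as a $B$-variety over $L$).
   Context: All rings are commutative and unital. A biderivation on a ring $R$ is a function $\{\cdot,\cdot\}:R\times R\to R$ such that for each $r\in R$ both $\{r,\cdot\}$ and $\{\cdot,r\}$ are derivations on $R$ (no linearity over a base is assumed); $(R,\{\cdot,\cdot\})$ is then a bidifferential ring (bidifferential field if $R$ is a field). A ring homomorphism $\phi$ of bidifferential rings is bidifferential if $\phi\{a,b\}=\{\phi a,\phi b\}$; the target is then said to be an extension of the source. A biderivation on an integral domain extends uniquely to the fraction field. A bidifferential ideal is an ideal $I$ with $\{R,I\}\subseteq I$ and $\{I,R\}\subseteq I$. A bidifferential ideal pair of $R$ is a pair of ideals $(I,J)$ with $\{I,R\}\subseteq I$ and $\{R,J\}\subseteq J$. An extension $R\to R'$ of bidifferential rings is lifting if $(IR',JR')$ is a bidifferential ideal pair of $R'$ whenever $(I,J)$ is a bidifferential ideal pair of $R$. A $B$-variety over a bidifferential field $k$ is an affine algebraic variety $X$ over $k$ together with a biderivation on $k[X]$ extending that on $k$. A $B$-subvariety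 of $X$ is a subvariety whose vanishing ideal is a bidifferential ideal (it is then a $B$-variety with the induced biderivation on the quotient). A $B$-point of $X$ over $k$ is a $k$-point which as a singleton is a $B$-subvariety; the set of $B$-points over $k$ is denoted $X^\sharp(k)$. A $B$-morphism is a regular map $\phi:X\to Y$ such that $\phi^*:k[Y]\to k[X]$ is bidifferential. If $k\subseteq L$ is an extension of bidifferential fields and $X$ is a $B$-variety over $k$, write $X_L=X\times_k L$. A compatible $B$-variety structure on $X_L$ (a compatible base extension) is a biderivation on $L[X_L]=k[X]\otimes_k L$ that extends the given biderivations on $k[X]$ and on $L$, and such that $k[X]\subseteq L[X_L]$ is a lifting extension. Given a dominant $B$-morphism $\phi:X\to Y$ of irreducible $B$-varieties over $k$, a generic $B$-fibre of $\phi$ over $L$ consists of: a bidifferential field extension $L\supseteq k$; compatible base extensions $X_L$ and $Y_L$ such that $\phi_L:X_L\to Y_L$ is a $B$-morphism; and a $B$-point $\alpha\in Y_L^\sharp(L)$ that is Zariski generic in $Y_L$ over $k$ (i.e. contained in no proper closed subvariety of $Y$ defined over $k$) such that $X_\alpha:=\phi_L^{-1}(\alpha)$ is a $B$-subvariety of $X_L$. Here $L=k(Y)$ is equipped with the unique biderivation extending that of $k[Y]$; for this $L$ a generic $B$-fibre with $k(\alpha)=L$ exists. An irreducible $B$-variety $X$ over $k$ is $B$-locally-closed if in $k[X]$ the zero ideal is not equal to the intersection of all nonzero prime bidifferential ideals (an empty intersection being $k[X]$); the same definition is used over $L$. *)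

theory Defs
  imports "HOL-Algebra.Algebra"
begin

section \<open>Bidifferential rings\<close>

record 'a biring = "'a ring" +
  bracket :: "'a \<Rightarrow> 'a \<Rightarrow> 'a"

definition derivation :: "('a, 'm) ring_scheme \<Rightarrow> ('a \<Rightarrow> 'a) \<Rightarrow> bool" where
  "derivation R d \<longleftrightarrow>
     d \<in> carrier R \<rightarrow> carrier R \<and>
     (\<forall>a\<in>carrier R. \<forall>b\<in>carrier R. d (a \<oplus>\<^bsub>R\<^esub> b) = d a \<oplus>\<^bsub>R\<^esub> d b) \<and>
     (\<forall>a\<in>carrier R. \<forall>b\<in>carrier R.
        d (a \<otimes>\<^bsub>R\<^esub> b) = (a \<otimes>\<^bsub>R\<^esub> d b) \<oplus>\<^bsub>R\<^esub> (d a \<otimes>\<^bsub>R\<^esub> b))"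

definition bidifferential_ring :: "('a, 'm) biring_scheme \<Rightarrow> bool" where
  "bidifferential_ring R \<longleftrightarrow> cring R \<and>
     (\<forall>r\<in>carrier R. derivation R (\<lambda>s. bracket R r s) \<and> derivation R (\<lambda>s. bracket R s r))"

definition bidifferential_field :: "('a, 'm) biring_scheme \<Rightarrow> bool" where
  "bidifferential_field R \<longleftrightarrow> field R \<and> bidifferential_ring R"

definition characteristic_zero :: "('a, 'm) ring_scheme \<Rightarrow> bool" where
  "characteristic_zero R \<longleftrightarrow> (\<forall>n::nat. n > 0 \<longrightarrow> [n] \<cdot>\<^bsub>R\<^esub> \<one>\<^bsub>R\<^esub> \<noteq> \<zero>\<^bsub>R\<^esub>)"

definition bidifferential_hom ::
    "('a, 'm) biring_scheme \<Rightarrow> ('b, 'n) biring_scheme \<Rightarrow> ('a \<Rightarrow> 'b) set" where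
  "bidifferential_hom R S = {h \<in> ring_hom R S.
     \<forall>a\<in>carrier R. \<forall>b\<in>carrier R. h (bracket R a b) = bracket S (h a) (h b)}"

definition bidifferential_ideal :: "('a, 'm) biring_scheme \<Rightarrow> 'a set \<Rightarrow> bool" where
  "bidifferential_ideal R I \<longleftrightarrow> ideal I R \<and>
     (\<forall>r\<in>carrier R. \<forall>a\<in>I. bracket R r a \<in> I \<and> bracket R a r \<in> I)"

definition bidifferential_ideal_pair ::
    "('a, 'm) biring_scheme \<Rightarrow> 'a set \<Rightarrow> 'a set \<Rightarrow> bool" where
  "bidifferential_ideal_pair R I J \<longleftrightarrow> ideal I R \<and> ideal J R \<and>
     (\<forall>r\<in>carrier R. \<forall>a\<in>I. bracket R a r \<in> I) \<and>
     (\<forall>r\<in>carrier R. \<forall>b\<in>J. bracket R r b \<in> J)"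

definition lifting_extension ::
    "('a, 'm) biring_scheme \<Rightarrow> ('b, 'n) biring_scheme \<Rightarrow> ('a \<Rightarrow> 'b) \<Rightarrow> bool" where
  "lifting_extension R S h \<longleftrightarrow> h \<in> bidifferential_hom R S \<and>
     (\<forall>I J. bidifferential_ideal_pair R I J \<longrightarrow>
        bidifferential_ideal_pair S (Idl\<^bsub>S\<^esub> (h ` I)) (Idl\<^bsub>S\<^esub> (h ` J)))"


section \<open>The Zariski topology\<close>

text \<open>
  An affine variety is given by its coordinate ring \<open>A\<close>, and its points are the prime
  ideals of \<open>A\<close>. For a finitely generated algebra over a field, this gives the same
  closed subvarieties and vanishing ideals as points over an algebraic closure.
\<close>

definition Spec :: "('a, 'm) ring_scheme \<Rightarrow> 'a set set" where
  "Spec A = {P. primeideal P A}"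

definition zariski_closed :: "('a, 'm) ring_scheme \<Rightarrow> 'a set set \<Rightarrow> bool" where
  "zariski_closed A Z \<longleftrightarrow> (\<exists>I. ideal I A \<and> Z = {P \<in> Spec A. I \<subseteq> P})"

definition vanishing_ideal :: "('a, 'm) ring_scheme \<Rightarrow> 'a set set \<Rightarrow> 'a set" where
  "vanishing_ideal A Z = {a \<in> carrier A. \<forall>P\<in>Z. a \<in> P}"

definition irreducible_spec :: "('a, 'm) ring_scheme \<Rightarrow> bool" where
  "irreducible_spec A \<longleftrightarrow> Spec A \<noteq> {} \<and>
     (\<forall>Z Z'. zariski_closed A Z \<longrightarrow> zariski_closed A Z' \<longrightarrow> Spec A = Z \<union> Z' \<longrightarrow>
        Spec A = Z \<or> Spec A = Z')"

definition reduced_ring :: "('a, 'm) ring_scheme \<Rightarrow> bool" where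
  "reduced_ring A \<longleftrightarrow>
     (\<forall>a\<in>carrier A. \<forall>n::nat. a [^]\<^bsub>A\<^esub> n = \<zero>\<^bsub>A\<^esub> \<longrightarrow> a = \<zero>\<^bsub>A\<^esub>)"

text \<open>The map of points \<open>Spec B \<rightarrow> Spec A\<close> induced by \<open>f : A \<rightarrow> B\<close>.\<close>

definition point_map :: "('a, 'm) ring_scheme \<Rightarrow> ('a \<Rightarrow> 'b) \<Rightarrow> 'b set \<Rightarrow> 'a set" where
  "point_map A f P = {a \<in> carrier A. f a \<in> P}"


section \<open>\<open>B\<close>-varieties\<close>

text \<open>
  A \<open>B\<close>-variety \<open>V\<close> over \<open>k\<close> is recorded as its coordinate ring \<open>k[V]\<close> with the
  biderivation and the structure map \<open>k \<rightarrow> k[V]\<close>. A regular map \<open>V \<rightarrow> W\<close> is recorded as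
  its comorphism \<open>k[W] \<rightarrow> k[V]\<close>, and a \<open>k\<close>-point as its evaluation map \<open>k[V] \<rightarrow> k\<close>.
\<close>

record ('k, 'a) bvariety = "'a biring" +
  scalar :: "'k \<Rightarrow> 'a"

definition B_variety :: "('k, 'n) biring_scheme \<Rightarrow> ('k, 'a, 'm) bvariety_scheme \<Rightarrow> bool" where
  "B_variety k V \<longleftrightarrow>
     bidifferential_field k \<and> bidifferential_ring V \<and>
     scalar V \<in> bidifferential_hom k V \<and>
     reduced_ring V \<and>
     (\<exists>S. finite S \<and> S \<subseteq> carrier V \<and>
        generate_ring V (scalar V ` carrier k \<union> S) = carrier V)"

definition irreducible_B_variety ::
    "('k, 'n) biring_scheme \<Rightarrow> ('k, 'a, 'm) bvariety_scheme \<Rightarrow> bool" where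
  "irreducible_B_variety k V \<longleftrightarrow> B_variety k V \<and> irreducible_spec V"

definition B_morphism ::
    "('k, 'n) biring_scheme \<Rightarrow> ('k, 'a, 'm) bvariety_scheme \<Rightarrow> ('k, 'b, 'p) bvariety_scheme
       \<Rightarrow> ('b \<Rightarrow> 'a) \<Rightarrow> bool" where
  "B_morphism k V W \<phi> \<longleftrightarrow> \<phi> \<in> bidifferential_hom W V \<and>
     (\<forall>c\<in>carrier k. \<phi> (scalar W c) = scalar V c)"

text \<open>Dominant means Zariski dense image.\<close>

definition dominant :: "('a, 'm) ring_scheme \<Rightarrow> ('b, 'n) ring_scheme \<Rightarrow> ('b \<Rightarrow> 'a) \<Rightarrow> bool" where
  "dominant V W \<phi> \<longleftrightarrow>
     (\<forall>Z. zariski_closed W Z \<longrightarrow> point_map W \<phi> ` Spec V \<subseteq> Z \<longrightarrow> Z = Spec W)"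

definition B_subvariety :: "('a, 'm) biring_scheme \<Rightarrow> 'a set set \<Rightarrow> bool" where
  "B_subvariety V Z \<longleftrightarrow> zariski_closed V Z \<and> bidifferential_ideal V (vanishing_ideal V Z)"

text \<open>
  A \<open>B\<close>-subvariety \<open>Z\<close> of \<open>V\<close> as a \<open>B\<close>-variety. Products and brackets of cosets are
  formed elementwise, as in \<^const>\<open>FactRing\<close>.
\<close>

definition subvariety ::
    "('k, 'a, 'm) bvariety_scheme \<Rightarrow> 'a set set \<Rightarrow> ('k, 'a set) bvariety" where
  "subvariety V Z = (let I = vanishing_ideal V Z in
     \<lparr>carrier = carrier (V Quot I), monoid.mult = monoid.mult (V Quot I),
      monoid.one = monoid.one (V Quot I),
      ring.zero = ring.zero (V Quot I), ring.add = ring.add (V Quot I),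
      bracket = (\<lambda>A B. \<Union>u\<in>A. \<Union>v\<in>B. I +>\<^bsub>V\<^esub> bracket V u v),
      scalar = (\<lambda>c. I +>\<^bsub>V\<^esub> scalar V c)\<rparr>)"

definition rational_point ::
    "('k, 'n) ring_scheme \<Rightarrow> ('k, 'a, 'm) bvariety_scheme \<Rightarrow> ('a \<Rightarrow> 'k) \<Rightarrow> bool" where
  "rational_point k V \<alpha> \<longleftrightarrow> \<alpha> \<in> ring_hom V k \<and> (\<forall>c\<in>carrier k. \<alpha> (scalar V c) = c)"

definition B_point ::
    "('k, 'n) ring_scheme \<Rightarrow> ('k, 'a, 'm) bvariety_scheme \<Rightarrow> ('a \<Rightarrow> 'k) \<Rightarrow> bool" where
  "B_point k V \<alpha> \<longleftrightarrow> rational_point k V \<alpha> \<and> B_subvariety V {a_kernel V k \<alpha>}"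

definition B_locally_closed ::
    "('k, 'n) biring_scheme \<Rightarrow> ('k, 'a, 'm) bvariety_scheme \<Rightarrow> bool" where
  "B_locally_closed k V \<longleftrightarrow> irreducible_B_variety k V \<and>
     {a \<in> carrier V. \<forall>P. primeideal P V \<longrightarrow> bidifferential_ideal V P \<longrightarrow>
        P \<noteq> {\<zero>\<^bsub>V\<^esub>} \<longrightarrow> a \<in> P} \<noteq> {\<zero>\<^bsub>V\<^esub>}"


section \<open>Base extension\<close>

text \<open>
  \<open>T\<close> with \<open>i : A \<rightarrow> T\<close> and \<open>j : B \<rightarrow> T\<close> is the tensor product of \<open>f : k \<rightarrow> A\<close> and
  \<open>g : k \<rightarrow> B\<close>: the map sending the formal symbol \<open>(a, b)\<close> to \<open>i a \<cdot> j b\<close> identifies \<open>T\<close>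
  with the free abelian group on \<open>A \<times> B\<close> modulo the usual bilinear relations.
\<close>

definition tensor_relations ::
    "('k, 'q) ring_scheme \<Rightarrow> ('a, 'm) ring_scheme \<Rightarrow> ('k \<Rightarrow> 'a) \<Rightarrow> ('b, 'n) ring_scheme
       \<Rightarrow> ('k \<Rightarrow> 'b) \<Rightarrow> ('a \<times> 'b \<Rightarrow>\<^sub>0 int) set" where
  "tensor_relations k A f B g =
     {frag_of (a \<oplus>\<^bsub>A\<^esub> a', b) - frag_of (a, b) - frag_of (a', b) | a a' b.
        a \<in> carrier A \<and> a' \<in> carrier A \<and> b \<in> carrier B} \<union>
     {frag_of (a, b \<oplus>\<^bsub>B\<^esub> b') - frag_of (a, b) - frag_of (a, b') | a b b'.
        a \<in> carrier A \<and> b \<in> carrier B \<and> b' \<in> carrier B} \<union>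
     {frag_of (f c \<otimes>\<^bsub>A\<^esub> a, b) - frag_of (a, g c \<otimes>\<^bsub>B\<^esub> b) | a b c.
        a \<in> carrier A \<and> b \<in> carrier B \<and> c \<in> carrier k}"

definition tensor_map ::
    "('t, 'm) ring_scheme \<Rightarrow> ('a \<Rightarrow> 't) \<Rightarrow> ('b \<Rightarrow> 't) \<Rightarrow> ('a \<times> 'b \<Rightarrow>\<^sub>0 int) \<Rightarrow> 't" where
  "tensor_map T i j x =
     (\<Oplus>\<^bsub>T\<^esub>p\<in>Poly_Mapping.keys x. [Poly_Mapping.lookup x p] \<cdot>\<^bsub>T\<^esub> (i (fst p) \<otimes>\<^bsub>T\<^esub> j (snd p)))"

definition is_tensor_product ::
    "('k, 'q) ring_scheme \<Rightarrow> ('a, 'm) ring_scheme \<Rightarrow> ('k \<Rightarrow> 'a) \<Rightarrow> ('b, 'n) ring_scheme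
       \<Rightarrow> ('k \<Rightarrow> 'b) \<Rightarrow> ('t, 'p) ring_scheme \<Rightarrow> ('a \<Rightarrow> 't) \<Rightarrow> ('b \<Rightarrow> 't) \<Rightarrow> bool" where
  "is_tensor_product k A f B g T i j \<longleftrightarrow>
     (let F = free_Abelian_group (carrier A \<times> carrier B) in
        cring T \<and> i \<in> ring_hom A T \<and> j \<in> ring_hom B T \<and>
        tensor_map T i j ` carrier F = carrier T \<and>
        {x \<in> carrier F. tensor_map T i j x = \<zero>\<^bsub>T\<^esub>} = generate F (tensor_relations k A f B g))"

text \<open>
  \<open>VL\<close> is \<open>V \<times>\<^sub>k L\<close> with a compatible \<open>B\<close>-variety structure, where \<open>h : k \<rightarrow> L\<close> is the
  field extension and \<open>i : k[V] \<rightarrow> L[VL]\<close> the canonical map.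
\<close>

definition compatible_base_extension ::
    "('k, 'n) biring_scheme \<Rightarrow> ('k, 'a, 'm) bvariety_scheme \<Rightarrow> ('l, 'p) biring_scheme
       \<Rightarrow> ('k \<Rightarrow> 'l) \<Rightarrow> ('l, 't, 'q) bvariety_scheme \<Rightarrow> ('a \<Rightarrow> 't) \<Rightarrow> bool" where
  "compatible_base_extension k V L h VL i \<longleftrightarrow>
     is_tensor_product k V (scalar V) L h VL i (scalar VL) \<and>
     bidifferential_ring VL \<and>
     i \<in> bidifferential_hom V VL \<and>
     scalar VL \<in> bidifferential_hom L VL \<and>
     lifting_extension V VL i"

definition fibre ::
    "('t, 'm) ring_scheme \<Rightarrow> ('s, 'n) ring_scheme \<Rightarrow> ('s \<Rightarrow> 't) \<Rightarrow> 's set \<Rightarrow> 't set set" where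
  "fibre V W \<phi> Q = {P \<in> Spec V. point_map W \<phi> P = Q}"

definition zariski_generic :: "('a, 'm) ring_scheme \<Rightarrow> 'a set \<Rightarrow> bool" where
  "zariski_generic W Q \<longleftrightarrow> (\<forall>Z. zariski_closed W Z \<longrightarrow> Q \<in> Z \<longrightarrow> Z = Spec W)"

text \<open>
  A generic \<open>B\<close>-fibre of \<open>\<phi> : V \<rightarrow> W\<close> over \<open>L\<close>. The two equations on \<open>\<phi>L\<close> (one of them
  inside \<open>B_morphism\<close>) say that it is the base change of \<open>\<phi>\<close>. Genericity over \<open>k\<close> is
  tested on the image of \<open>\<alpha>\<close> under the projection from \<open>WL\<close> to \<open>W\<close>.
\<close>

definition generic_B_fibre ::
    "('k, 'n) biring_scheme \<Rightarrow> ('k, 'a, 'm) bvariety_scheme \<Rightarrow> ('k, 'b, 'p) bvariety_scheme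
       \<Rightarrow> ('b \<Rightarrow> 'a) \<Rightarrow> ('l, 'q) biring_scheme \<Rightarrow> ('k \<Rightarrow> 'l)
       \<Rightarrow> ('l, 's, 'u) bvariety_scheme \<Rightarrow> ('a \<Rightarrow> 's) \<Rightarrow> ('l, 't, 'v) bvariety_scheme \<Rightarrow> ('b \<Rightarrow> 't)
       \<Rightarrow> ('t \<Rightarrow> 's) \<Rightarrow> ('t \<Rightarrow> 'l) \<Rightarrow> bool" where
  "generic_B_fibre k V W \<phi> L h VL iV WL iW \<phi>L \<alpha> \<longleftrightarrow>
     bidifferential_field L \<and> h \<in> bidifferential_hom k L \<and>
     compatible_base_extension k V L h VL iV \<and>
     compatible_base_extension k W L h WL iW \<and>
     B_morphism L VL WL \<phi>L \<and>
     (\<forall>y\<in>carrier W. \<phi>L (iW y) = iV (\<phi> y)) \<and>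
     B_point L WL \<alpha> \<and>
     zariski_generic W (point_map W iW (a_kernel WL L \<alpha>)) \<and>
     B_subvariety VL (fibre VL WL \<phi>L (a_kernel WL L \<alpha>))"

text \<open>The subfield \<open>k(\<alpha>)\<close> of \<open>L\<close> generated over \<open>k\<close> by the coordinates of \<open>\<alpha>\<close>.\<close>

definition field_of_point ::
    "('k, 'n) ring_scheme \<Rightarrow> ('b, 'm) ring_scheme \<Rightarrow> ('l, 'q) ring_scheme \<Rightarrow> ('k \<Rightarrow> 'l)
       \<Rightarrow> ('b \<Rightarrow> 't) \<Rightarrow> ('t \<Rightarrow> 'l) \<Rightarrow> 'l set" where
  "field_of_point k W L h iW \<alpha> =
     generate_field L (h ` carrier k \<union> (\<lambda>y. \<alpha> (iW y)) ` carrier W)"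

text \<open>
  \<open>L\<close> is the fraction field of \<open>k[W]\<close>, via \<open>\<iota> : k[W] \<rightarrow> L\<close>, with a biderivation
  extending that of \<open>k[W]\<close> (which is thereby determined).
\<close>

definition is_function_field ::
    "('b, 'm) biring_scheme \<Rightarrow> ('l, 'q) biring_scheme \<Rightarrow> ('b \<Rightarrow> 'l) \<Rightarrow> bool" where
  "is_function_field W L \<iota> \<longleftrightarrow> bidifferential_field L \<and>
     \<iota> \<in> bidifferential_hom W L \<and> inj_on \<iota> (carrier W) \<and>
     (\<forall>x\<in>carrier L. \<exists>a\<in>carrier W. \<exists>b\<in>carrier W.
        b \<noteq> \<zero>\<^bsub>W\<^esub> \<and> x = \<iota> a \<otimes>\<^bsub>L\<^esub> inv\<^bsub>L\<^esub> (\<iota> b))"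

end

theory Submission
  imports Defs
begin

text \<open>
  Write \<open>A = k[V]\<close>, \<open>B = k[W]\<close> and \<open>L = Frac B\<close>, where \<open>L\<close> is identified with the
  fraction field of \<open>B\<close> through the generic point \<open>\<alpha>\<close>. The coordinate ring of the generic
  fibre is the localization \<open>S\<^sup>-\<^sup>1A\<close> of \<open>A\<close> at the image \<open>S\<close> of \<open>B - {0}\<close>, because
  \<open>(A \<otimes> L) / (ker \<alpha>) = A \<otimes>\<^sub>B L\<close>. A nonzero bidifferential prime of \<open>S\<^sup>-\<^sup>1A\<close> contracts to a
  nonzero bidifferential prime of \<open>A\<close>, and a nonzero bidifferential prime of \<open>A\<close> that does not
  meet \<open>S\<close> extends to one of \<open>S\<^sup>-\<^sup>1A\<close>. So if \<open>a\<close> lies in all nonzero bidifferential primes of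
  \<open>A\<close>, it lies in all those of \<open>S\<^sup>-\<^sup>1A\<close>. Conversely, if \<open>a / b\<close> lies in all those of \<open>S\<^sup>-\<^sup>1A\<close> and
  \<open>c\<close> in all those of \<open>B\<close>, then \<open>a c\<close> lies in all those of \<open>A\<close>, since a prime of \<open>A\<close> meeting \<open>S\<close>
  contracts to a nonzero prime of \<open>B\<close>.
\<close>

section \<open>Irreducibility and integral domains\<close>

text \<open>The fibre is given as a set of primes, and its coordinate ring is \<open>VL\<close>
  modulo the intersection \<open>I\<close> of these primes. Nothing says that \<open>I\<close> is
  generated by the image of the kernel of \<alpha>, or that it is a proper ideal, so the tensor
  product over B in the overview is not computed. Three facts replace it. Modulo \<open>I\<close> a
  function b on W equals the scalar \<beta> b of L, hence is a unit if it is nonzero. Every element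
  of the quotient becomes the class of an element of k[V] after multiplication by such a unit. And
  k[V] embeds in the quotient. For the last fact one needs a point of the fibre at which no nonzero
  element of k[V] vanishes: the kernel of a homomorphism from \<open>VL\<close> to the fraction
  field of k[V], which exists by the universal property of the tensor product. This kernel turns out
  to be \<open>I\<close> itself, so the fibre is integral. No quotient rule for brackets is used. A
  fraction f = a / b is treated as the equation f b = a, the Leibniz rule is applied to it, and b is
  cancelled modulo a prime that avoids it.\<close>

lemma (in cring) nilpotent_if_in_all_primes:
  assumes a: "a \<in> carrier R" and all: "\<And>P. primeideal P R \<Longrightarrow> a \<in> P"
  shows "\<exists>n::nat. a [^] n = \<zero>"
proof (rule ccontr)
  assume nn: "\<nexists>n::nat. a [^] n = \<zero>"
  \<comment> \<open>Zorn's lemma gives an ideal \<open>M\<close> maximal among those that contain no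
    power of \<open>a\<close>. It is prime: adding \<open>x\<close> or \<open>y\<close> to it
    captures a power of \<open>a\<close> each time, and if \<open>x \<otimes> y\<close> were in
    \<open>M\<close>, so would be the product of the two powers.\<close>
  define \<A> where "\<A> = {I. ideal I R \<and> (\<forall>n::nat. a [^] n \<notin> I)}"
  have zero: "{\<zero>} \<in> \<A>"
    using zeroideal nn by (auto simp: \<A>_def)
  have "\<exists>M\<in>\<A>. \<forall>N\<in>\<A>. M \<subseteq> N \<longrightarrow> N = M"
  proof (rule subset_Zorn_nonempty)
    show "\<A> \<noteq> {}" using zero by auto
    fix C assume C: "C \<noteq> {}" "subset.chain \<A> C"
    then have "subset.chain {I. ideal I R} C"
      by (auto simp: subset_chain_def \<A>_def)
    from chain_Union_is_ideal[OF this] C show "\<Union>C \<in> \<A>"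
      by (auto simp: subset_chain_def \<A>_def)
  qed
  then obtain M where M: "M \<in> \<A>" and max: "\<And>N. N \<in> \<A> \<Longrightarrow> M \<subseteq> N \<Longrightarrow> N = M" by blast
  interpret M: ideal M R using M by (simp add: \<A>_def)
  have aM: "a [^] n \<notin> M" for n :: nat using M by (simp add: \<A>_def)
  have power_in: "\<exists>(n::nat) m r. m \<in> M \<and> r \<in> carrier R \<and> a [^] n = m \<oplus> r \<otimes> x"
    if x: "x \<in> carrier R" "x \<notin> M" for x
  proof -
    have id: "ideal (M <+> PIdl x) R"
      using add_ideals[OF M.is_ideal cgenideal_ideal[OF x(1)]] .
    have sub: "M \<subseteq> M <+> PIdl x"
    proof
      fix m assume m: "m \<in> M"
      then have "m = m \<oplus> \<zero>" using M.Icarr by simp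
      moreover have "\<zero> \<in> PIdl x"
        by (rule additive_subgroup.zero_closed[OF ideal.axioms(1)[OF cgenideal_ideal[OF x(1)]]])
      ultimately show "m \<in> M <+> PIdl x" using m unfolding set_add_def' by blast
    qed
    have "x \<in> M <+> PIdl x"
    proof -
      have "x = \<zero> \<oplus> x" using x by simp
      then show ?thesis using cgenideal_self[OF x(1)] M.zero_closed unfolding set_add_def' by blast
    qed
    then have "M <+> PIdl x \<notin> \<A>" using max[OF _ sub] x by blast
    then obtain n :: nat where "a [^] n \<in> M <+> PIdl x" using id by (auto simp: \<A>_def)
    then show ?thesis unfolding set_add_def' cgenideal_def by blast
  qed
  have "primeideal M R"
  proof (rule primeidealI[OF M.is_ideal is_cring])
    \<comment> \<open>The power with exponent 0 is the unit, so avoiding it makes \<open>M\<close>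
      proper.\<close>
    show "carrier R \<noteq> M" using aM[of 0] by auto
    fix x y assume x: "x \<in> carrier R" and y: "y \<in> carrier R" and xy: "x \<otimes> y \<in> M"
    show "x \<in> M \<or> y \<in> M"
    proof (rule ccontr)
      assume "\<not> (x \<in> M \<or> y \<in> M)"
      then obtain n n' :: nat and m r m' r'
        where 1: "m \<in> M" "r \<in> carrier R" "a [^] n = m \<oplus> r \<otimes> x"
          and 2: "m' \<in> M" "r' \<in> carrier R" "a [^] n' = m' \<oplus> r' \<otimes> y"
        using power_in x y by metis
      have mc: "m \<in> carrier R" "m' \<in> carrier R" using 1 2 M.Icarr by auto
      have "a [^] (n + n') = a [^] n \<otimes> a [^] n'" using a by (simp add: nat_pow_mult)
      also have "\<dots> = (m' \<oplus> r' \<otimes> y) \<otimes> m \<oplus> (r \<otimes> x) \<otimes> m' \<oplus> (r \<otimes> r') \<otimes> (x \<otimes> y)"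
        unfolding 1(3) 2(3) using mc x y 1(2) 2(2) by algebra
      also have "\<dots> \<in> M"
        using 1(1,2) 2(1,2) xy mc x y by (intro M.a_closed) (auto intro: M.I_l_closed)
      finally show False using aM by blast
    qed
  qed
  from all[OF this] aM[of 1] a show False by simp
qed

text \<open>If \<open>a \<otimes> b\<close> is zero, every prime contains \<open>a\<close> or
  \<open>b\<close>, so the two zero loci cover the spectrum. By irreducibility one of them is
  everything; that factor lies in all primes, hence is nilpotent, hence zero. A nonempty spectrum
  gives distinct unit and zero.\<close>

lemma domain_if_reduced_irreducible:
  fixes R (structure)
  assumes "cring R" "reduced_ring R" "irreducible_spec R"
  shows "domain R"
proof -
  interpret cring R by fact
  have closed: "zariski_closed R {P \<in> Spec R. PIdl a \<subseteq> P}" if "a \<in> carrier R" for a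
    using cgenideal_ideal[OF that] unfolding zariski_closed_def by blast
  have whole: "a = \<zero>" if a: "a \<in> carrier R" and eq: "Spec R = {P \<in> Spec R. PIdl a \<subseteq> P}" for a
  proof -
    have "a \<in> P" if "primeideal P R" for P
      using that eq cgenideal_self[OF a] unfolding Spec_def by blast
    then show ?thesis
      using nilpotent_if_in_all_primes[OF a] assms(2) a unfolding reduced_ring_def by blast
  qed
  show ?thesis
  proof (intro domain.intro domain_axioms.intro is_cring)
    obtain P where P: "primeideal P R" using assms(3) by (auto simp: irreducible_spec_def Spec_def)
    then interpret P: primeideal P R .
    show "\<one> \<noteq> \<zero>" using P.I_notcarr P.zero_closed P.one_imp_carrier by metis
  next
    fix a b assume ab: "a \<otimes> b = \<zero>" "a \<in> carrier R" "b \<in> carrier R"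
    have "Spec R = {P \<in> Spec R. PIdl a \<subseteq> P} \<union> {P \<in> Spec R. PIdl b \<subseteq> P}"
    proof -
      have "PIdl a \<subseteq> P \<or> PIdl b \<subseteq> P" if "primeideal P R" for P
      proof -
        interpret P: primeideal P R by fact
        have "a \<in> P \<or> b \<in> P" using ab P.I_prime P.zero_closed by metis
        then show ?thesis using cgenideal_minimal[OF P.is_ideal] by blast
      qed
      then show ?thesis by (auto simp: Spec_def)
    qed
    then have "Spec R = {P \<in> Spec R. PIdl a \<subseteq> P} \<or> Spec R = {P \<in> Spec R. PIdl b \<subseteq> P}"
      using assms(3) closed[OF ab(2)] closed[OF ab(3)] unfolding irreducible_spec_def by meson
    then show "a = \<zero> \<or> b = \<zero>"
      using whole[OF ab(2)] whole[OF ab(3)] by meson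
  qed
qed

text \<open>The zero ideal is a generic point: a closed set containing it is the whole
  spectrum.\<close>

lemma irreducible_spec_domain:
  fixes R (structure)
  assumes "domain R"
  shows "irreducible_spec R"
proof -
  interpret domain R by fact
  have "primeideal {\<zero>} R" by (rule zeroprimeideal)
  moreover have "Z = Spec R" if Z: "zariski_closed R Z" "{\<zero>} \<in> Z" for Z
  proof -
    from Z obtain I where I: "ideal I R" "Z = {P \<in> Spec R. I \<subseteq> P}" by (auto simp: zariski_closed_def)
    have "I \<subseteq> P" if "P \<in> Spec R" for P
    proof -
      have "\<zero> \<in> P"
        using that unfolding Spec_def
        by (simp add: additive_subgroup.zero_closed ideal_def primeideal_def)
      then show ?thesis using I Z(2) by auto
    qed
    then show ?thesis using I by auto
  qed
  ultimately show ?thesis unfolding irreducible_spec_def Spec_def by blast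
qed

lemma reduced_ring_domain:
  fixes R (structure)
  assumes "domain R"
  shows "reduced_ring R"
proof -
  interpret domain R by fact
  show ?thesis unfolding reduced_ring_def
  proof (intro ballI allI impI)
    fix a and n :: nat assume a: "a \<in> carrier R" and "a [^] n = \<zero>"
    then show "a = \<zero>" by (induction n) (auto simp: integral_iff)
  qed
qed

section \<open>The fraction field of a domain\<close>

context domain
begin

text \<open>The class of the fraction a/s under cross multiplication. The field made of these
  classes is the target of the homomorphism built in \<open>exists_generic_prime\<close>.\<close>

definition frac :: "'a \<Rightarrow> 'a \<Rightarrow> ('a \<times> 'a) set" where
  "frac a s = {(b, t). b \<in> carrier R \<and> t \<in> carrier R - {\<zero>} \<and> a \<otimes> t = b \<otimes> s}"

definition frac_rep :: "('a \<times> 'a) set \<Rightarrow> 'a \<times> 'a" where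
  "frac_rep N = (SOME p. p \<in> N)"

text \<open>The operations use representatives picked by choice; \<open>frac_mult\<close> and
  \<open>frac_add\<close> remove the dependence on the pick.\<close>

definition fraction_ring :: "('a \<times> 'a) set ring" where
  "fraction_ring = \<lparr>carrier = {frac a s | a s. a \<in> carrier R \<and> s \<in> carrier R - {\<zero>}},
     monoid.mult = (\<lambda>N Y. frac (fst (frac_rep N) \<otimes> fst (frac_rep Y)) (snd (frac_rep N) \<otimes> snd (frac_rep Y))),
     monoid.one = frac \<one> \<one>, ring.zero = frac \<zero> \<one>,
     ring.add = (\<lambda>N Y. frac (fst (frac_rep N) \<otimes> snd (frac_rep Y) \<oplus> fst (frac_rep Y) \<otimes> snd (frac_rep N))
       (snd (frac_rep N) \<otimes> snd (frac_rep Y)))\<rparr>"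

lemma frac_eq_iff:
  assumes "a \<in> carrier R" "s \<in> carrier R - {\<zero>}" "b \<in> carrier R" "t \<in> carrier R - {\<zero>}"
  shows "frac a s = frac b t \<longleftrightarrow> a \<otimes> t = b \<otimes> s"
proof
  assume "frac a s = frac b t"
  moreover have "(b, t) \<in> frac b t" using assms by (auto simp: frac_def)
  ultimately show "a \<otimes> t = b \<otimes> s" by (auto simp: frac_def)
next
  \<comment> \<open>This is transitivity of cross multiplication: after multiplying by
    \<open>s\<close> both sides agree, and \<open>s\<close> cancels in a domain. The reverse
    inclusion follows by symmetry.\<close>
  have sub: "frac a s \<subseteq> frac b t"
    if e: "a \<otimes> t = b \<otimes> s" and c: "a \<in> carrier R" "s \<in> carrier R - {\<zero>}" "b \<in> carrier R" "t \<in> carrier R - {\<zero>}"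
    for a b s t
  proof
    fix z assume "z \<in> frac a s"
    then obtain c u where z: "z = (c, u)" "c \<in> carrier R" "u \<in> carrier R - {\<zero>}" "a \<otimes> u = c \<otimes> s"
      by (auto simp: frac_def)
    have "s \<otimes> (b \<otimes> u) = (b \<otimes> s) \<otimes> u" using c z(2,3) by (simp add: m_ac)
    also have "\<dots> = (a \<otimes> u) \<otimes> t" unfolding e[symmetric] using c z(2,3) by (simp add: m_ac)
    also have "\<dots> = s \<otimes> (c \<otimes> t)" unfolding z(4) using c z(2,3) by (simp add: m_ac)
    finally have "b \<otimes> u = c \<otimes> t"
      using c z(2,3) m_lcancel[of s "b \<otimes> u" "c \<otimes> t"] by simp
    then show "z \<in> frac b t" using z by (auto simp: frac_def)
  qed
  assume e: "a \<otimes> t = b \<otimes> s"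
  show "frac a s = frac b t"
    using sub[OF e] sub[OF e[symmetric]] assms by blast
qed

lemma frac_rep_frac:
  assumes "a \<in> carrier R" "s \<in> carrier R - {\<zero>}"
  obtains b t where "frac_rep (frac a s) = (b, t)" "b \<in> carrier R" "t \<in> carrier R - {\<zero>}"
    "a \<otimes> t = b \<otimes> s"
proof -
  have "(a, s) \<in> frac a s" using assms by (auto simp: frac_def)
  then have "frac_rep (frac a s) \<in> frac a s" unfolding frac_rep_def by (rule someI)
  then show ?thesis using that by (auto simp: frac_def)
qed

lemma frac_mult:
  assumes "a \<in> carrier R" "s \<in> carrier R - {\<zero>}" "b \<in> carrier R" "t \<in> carrier R - {\<zero>}"
  shows "frac a s \<otimes>\<^bsub>fraction_ring\<^esub> frac b t = frac (a \<otimes> b) (s \<otimes> t)"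
proof -
  obtain a' s' where 1: "frac_rep (frac a s) = (a', s')" "a' \<in> carrier R" "s' \<in> carrier R - {\<zero>}"
    "a \<otimes> s' = a' \<otimes> s" using frac_rep_frac assms by metis
  obtain b' t' where 2: "frac_rep (frac b t) = (b', t')" "b' \<in> carrier R" "t' \<in> carrier R - {\<zero>}"
    "b \<otimes> t' = b' \<otimes> t" using frac_rep_frac assms by metis
  have "(a' \<otimes> b') \<otimes> (s \<otimes> t) = (a' \<otimes> s) \<otimes> (b' \<otimes> t)" using assms 1(2,3) 2(2,3) by (simp add: m_ac)
  also have "\<dots> = (a \<otimes> b) \<otimes> (s' \<otimes> t')"
    unfolding 1(4)[symmetric] 2(4)[symmetric] using assms 1(2,3) 2(2,3) by (simp add: m_ac)
  finally have "frac (a' \<otimes> b') (s' \<otimes> t') = frac (a \<otimes> b) (s \<otimes> t)"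
    using assms 1(2,3) 2(2,3) by (subst frac_eq_iff) (auto simp: integral_iff)
  then show ?thesis by (simp add: fraction_ring_def 1 2)
qed

lemma frac_add:
  assumes "a \<in> carrier R" "s \<in> carrier R - {\<zero>}" "b \<in> carrier R" "t \<in> carrier R - {\<zero>}"
  shows "frac a s \<oplus>\<^bsub>fraction_ring\<^esub> frac b t = frac (a \<otimes> t \<oplus> b \<otimes> s) (s \<otimes> t)"
proof -
  obtain a' s' where 1: "frac_rep (frac a s) = (a', s')" "a' \<in> carrier R" "s' \<in> carrier R - {\<zero>}"
    "a \<otimes> s' = a' \<otimes> s" using frac_rep_frac assms by metis
  obtain b' t' where 2: "frac_rep (frac b t) = (b', t')" "b' \<in> carrier R" "t' \<in> carrier R - {\<zero>}"
    "b \<otimes> t' = b' \<otimes> t" using frac_rep_frac assms by metis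
  note c = assms 1(2,3) 2(2,3)
  have "(a' \<otimes> t' \<oplus> b' \<otimes> s') \<otimes> (s \<otimes> t) = (a' \<otimes> s) \<otimes> (t' \<otimes> t) \<oplus> (b' \<otimes> t) \<otimes> (s' \<otimes> s)"
    using c by (simp add: l_distr r_distr m_ac a_ac)
  also have "\<dots> = (a \<otimes> t \<oplus> b \<otimes> s) \<otimes> (s' \<otimes> t')"
    unfolding 1(4)[symmetric] 2(4)[symmetric] using c by (simp add: l_distr r_distr m_ac a_ac)
  finally have "frac (a' \<otimes> t' \<oplus> b' \<otimes> s') (s' \<otimes> t') = frac (a \<otimes> t \<oplus> b \<otimes> s) (s \<otimes> t)"
    using c by (subst frac_eq_iff) (auto simp: integral_iff)
  then show ?thesis by (simp add: fraction_ring_def 1 2)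
qed

lemma carrier_fraction_ringE:
  assumes "x \<in> carrier fraction_ring"
  obtains a s where "x = frac a s" "a \<in> carrier R" "s \<in> carrier R" "s \<noteq> \<zero>"
  using assms by (auto simp: fraction_ring_def)

lemma frac_closed:
  "a \<in> carrier R \<Longrightarrow> s \<in> carrier R \<Longrightarrow> s \<noteq> \<zero> \<Longrightarrow> frac a s \<in> carrier fraction_ring"
  by (auto simp: fraction_ring_def)

lemma fraction_ring_one: "\<one>\<^bsub>fraction_ring\<^esub> = frac \<one> \<one>"
  and fraction_ring_zero: "\<zero>\<^bsub>fraction_ring\<^esub> = frac \<zero> \<one>"
  by (simp_all add: fraction_ring_def)

lemmas fraction_simps = frac_mult frac_add fraction_ring_one fraction_ring_zero frac_closed frac_eq_iff

lemma field_fraction_ring: "field fraction_ring"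
proof -
  have "cring fraction_ring"
  proof (intro cringI abelian_groupI comm_monoidI; (elim carrier_fraction_ringE)?)
    fix x a s assume "x = frac a s" "a \<in> carrier R" "s \<in> carrier R" "s \<noteq> \<zero>"
    then show "\<exists>y\<in>carrier fraction_ring. y \<oplus>\<^bsub>fraction_ring\<^esub> x = \<zero>\<^bsub>fraction_ring\<^esub>"
      by (intro bexI[of _ "frac (\<ominus> a) s"]) (simp_all add: fraction_simps integral_iff l_minus l_neg)
  qed (simp_all add: fraction_simps integral_iff l_distr r_distr m_ac a_ac)
  then show ?thesis
  proof (rule cring.cring_fieldI2)
    show "\<zero>\<^bsub>fraction_ring\<^esub> \<noteq> \<one>\<^bsub>fraction_ring\<^esub>" by (simp add: fraction_simps)
    fix x assume "x \<in> carrier fraction_ring" "x \<noteq> \<zero>\<^bsub>fraction_ring\<^esub>"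
    then show "\<exists>y\<in>carrier fraction_ring. x \<otimes>\<^bsub>fraction_ring\<^esub> y = \<one>\<^bsub>fraction_ring\<^esub>"
    proof (elim carrier_fraction_ringE)
      fix a s assume h: "x \<noteq> \<zero>\<^bsub>fraction_ring\<^esub>" "x = frac a s" "a \<in> carrier R" "s \<in> carrier R" "s \<noteq> \<zero>"
      then have "a \<noteq> \<zero>" by (auto simp: fraction_simps)
      then show ?thesis using h
        by (intro bexI[of _ "frac s a"]) (simp_all add: fraction_simps integral_iff m_ac)
    qed
  qed
qed

lemma frac_ring_hom: "(\<lambda>a. frac a \<one>) \<in> ring_hom R fraction_ring"
  by (rule ring_hom_memI) (simp_all add: fraction_simps)

lemma frac_inj: "inj_on (\<lambda>a. frac a \<one>) (carrier R)"
  by (rule inj_onI) (simp add: fraction_simps)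

end

section \<open>Fractions from a domain inside a given field, and homomorphisms out of them\<close>

lemma (in field) generate_field_fractions:
  assumes "domain B" "\<beta> \<in> ring_hom B R" "inj_on \<beta> (carrier B)"
    and x: "x \<in> generate_field R (\<beta> ` carrier B)"
  shows "x \<in> carrier R \<and> (\<exists>a\<in>carrier B. \<exists>b\<in>carrier B. b \<noteq> \<zero>\<^bsub>B\<^esub> \<and> x \<otimes> \<beta> b = \<beta> a)"
proof -
  interpret B: domain B by fact
  interpret \<beta>: ring_hom_ring B R \<beta> by (intro ring_hom_ringI2 B.ring_axioms ring_axioms assms)
  show ?thesis
    using x
  proof (induction rule: generate_field.induct)
    case one
    show ?case by (intro conjI bexI[of _ "\<one>\<^bsub>B\<^esub>"]) auto
  next
    case (incl x)
    then obtain b where "b \<in> carrier B" "x = \<beta> b" by blast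
    then show ?case by (intro conjI bexI[of _ b] bexI[of _ "\<one>\<^bsub>B\<^esub>"]) auto
  next
    case (a_inv x)
    then obtain a b where "a \<in> carrier B" "b \<in> carrier B" "b \<noteq> \<zero>\<^bsub>B\<^esub>" "x \<otimes> \<beta> b = \<beta> a" "x \<in> carrier R" by blast
    then show ?case by (intro conjI bexI[of _ "\<ominus>\<^bsub>B\<^esub> a"] bexI[of _ b]) (auto simp: l_minus)
  next
    case (m_inv x)
    then obtain a b where ab: "a \<in> carrier B" "b \<in> carrier B" "b \<noteq> \<zero>\<^bsub>B\<^esub>" "x \<otimes> \<beta> b = \<beta> a"
      and x: "x \<in> carrier R" by blast
    then have u: "x \<in> Units R" using m_inv by (simp add: field_Units)
    have "inv x \<otimes> \<beta> a = (inv x \<otimes> x) \<otimes> \<beta> b"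
      unfolding ab(4)[symmetric] using ab(2) u x by (simp only: m_assoc Units_inv_closed \<beta>.hom_closed)
    then have *: "inv x \<otimes> \<beta> a = \<beta> b" using u x ab by simp
    have "\<beta> b \<noteq> \<zero>" using assms(3) ab \<beta>.hom_zero B.zero_closed inj_onD by metis
    then have "a \<noteq> \<zero>\<^bsub>B\<^esub>" using * u x by auto
    then show ?case using * ab u by auto
  next
    case (eng_add x y)
    then obtain a b c d where ab: "a \<in> carrier B" "b \<in> carrier B" "b \<noteq> \<zero>\<^bsub>B\<^esub>" "x \<otimes> \<beta> b = \<beta> a"
      and cd: "c \<in> carrier B" "d \<in> carrier B" "d \<noteq> \<zero>\<^bsub>B\<^esub>" "y \<otimes> \<beta> d = \<beta> c"
      and xy: "x \<in> carrier R" "y \<in> carrier R" by blast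
    have "(x \<oplus> y) \<otimes> \<beta> (b \<otimes>\<^bsub>B\<^esub> d) = (x \<otimes> \<beta> b) \<otimes> \<beta> d \<oplus> (y \<otimes> \<beta> d) \<otimes> \<beta> b"
      using ab(2) cd(2) xy by (simp add: l_distr r_distr m_ac)
    also have "\<dots> = \<beta> (a \<otimes>\<^bsub>B\<^esub> d \<oplus>\<^bsub>B\<^esub> c \<otimes>\<^bsub>B\<^esub> b)" unfolding ab(4) cd(4) using ab cd by simp
    finally show ?case using ab cd xy
      by (intro conjI bexI[of _ "a \<otimes>\<^bsub>B\<^esub> d \<oplus>\<^bsub>B\<^esub> c \<otimes>\<^bsub>B\<^esub> b"] bexI[of _ "b \<otimes>\<^bsub>B\<^esub> d"])
        (auto simp: B.integral_iff)
  next
    case (eng_mult x y)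
    then obtain a b c d where ab: "a \<in> carrier B" "b \<in> carrier B" "b \<noteq> \<zero>\<^bsub>B\<^esub>" "x \<otimes> \<beta> b = \<beta> a"
      and cd: "c \<in> carrier B" "d \<in> carrier B" "d \<noteq> \<zero>\<^bsub>B\<^esub>" "y \<otimes> \<beta> d = \<beta> c"
      and xy: "x \<in> carrier R" "y \<in> carrier R" by blast
    have "(x \<otimes> y) \<otimes> \<beta> (b \<otimes>\<^bsub>B\<^esub> d) = (x \<otimes> \<beta> b) \<otimes> (y \<otimes> \<beta> d)"
      using ab(2) cd(2) xy by (simp add: m_ac)
    also have "\<dots> = \<beta> (a \<otimes>\<^bsub>B\<^esub> c)" unfolding ab(4) cd(4) using ab cd by simp
    finally show ?case using ab cd xy
      by (intro conjI bexI[of _ "a \<otimes>\<^bsub>B\<^esub> c"] bexI[of _ "b \<otimes>\<^bsub>B\<^esub> d"]) (auto simp: B.integral_iff)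
  qed
qed

lemma (in cring) Units_r_cancel:
  assumes "u \<in> Units R" "x \<in> carrier R" "y \<in> carrier R" "x \<otimes> u = y \<otimes> u"
  shows "x = y"
  using assms Units_l_cancel[of u x y] by (simp add: m_comm[of _ u] Units_closed)

text \<open>The universal property of the fraction field, for any ring \<open>L\<close> whose
  elements are fractions from \<open>B\<close>. It does not presuppose the construction above, since
  \<open>L\<close> is handed over abstractly.\<close>

lemma fractions_hom_extension:
  assumes "domain B" "cring L" "cring K"
    and "\<beta> \<in> ring_hom B L" and inj: "inj_on \<beta> (carrier B)" and "f \<in> ring_hom B K"
    and units: "\<And>b. b \<in> carrier B \<Longrightarrow> b \<noteq> \<zero>\<^bsub>B\<^esub> \<Longrightarrow> f b \<in> Units K"
    and frac: "\<And>x. x \<in> carrier L \<Longrightarrow>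
      \<exists>a\<in>carrier B. \<exists>b\<in>carrier B. b \<noteq> \<zero>\<^bsub>B\<^esub> \<and> x \<otimes>\<^bsub>L\<^esub> \<beta> b = \<beta> a"
  obtains \<psi> where "\<psi> \<in> ring_hom L K" "\<And>b. b \<in> carrier B \<Longrightarrow> \<psi> (\<beta> b) = f b"
proof -
  interpret B: domain B by fact
  interpret L: cring L by fact
  interpret K: cring K by fact
  interpret \<beta>: ring_hom_ring B L \<beta> by (intro ring_hom_ringI2 B.ring_axioms L.ring_axioms assms)
  interpret f: ring_hom_ring B K f by (intro ring_hom_ringI2 B.ring_axioms K.ring_axioms assms)
  have "\<forall>x. \<exists>a b. x \<in> carrier L \<longrightarrow>
      a \<in> carrier B \<and> b \<in> carrier B \<and> b \<noteq> \<zero>\<^bsub>B\<^esub> \<and> x \<otimes>\<^bsub>L\<^esub> \<beta> b = \<beta> a"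
    using frac by blast
  then obtain nm dn where nd: "\<And>x. x \<in> carrier L \<Longrightarrow>
      nm x \<in> carrier B \<and> dn x \<in> carrier B \<and> dn x \<noteq> \<zero>\<^bsub>B\<^esub> \<and> x \<otimes>\<^bsub>L\<^esub> \<beta> (dn x) = \<beta> (nm x)"
    by metis
  define \<psi> where "\<psi> x = f (nm x) \<otimes>\<^bsub>K\<^esub> inv\<^bsub>K\<^esub> f (dn x)" for x
  have closed: "\<psi> x \<in> carrier K" if "x \<in> carrier L" for x
    using nd[OF that] units by (simp add: \<psi>_def)
  have nd': "\<psi> x \<otimes>\<^bsub>K\<^esub> f (dn x) = f (nm x)" if "x \<in> carrier L" for x
    using nd[OF that] units by (simp add: \<psi>_def K.m_assoc)
  \<comment> \<open>The value of \<psi> does not depend on the chosen numerator and denominator: two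
    representations of \<open>x\<close> agree after cross multiplication, injectivity of \<beta>
    moves this identity back to \<open>B\<close>, and the image of the denominator is a
    unit.\<close>
  have eval: "\<psi> x \<otimes>\<^bsub>K\<^esub> f b = f a"
    if x: "x \<in> carrier L" and ab: "a \<in> carrier B" "b \<in> carrier B" "x \<otimes>\<^bsub>L\<^esub> \<beta> b = \<beta> a" for x a b
  proof -
    note n = nd[OF x, THEN conjunct1] nd[OF x, THEN conjunct2, THEN conjunct1]
    have "\<beta> (nm x \<otimes>\<^bsub>B\<^esub> b) = (x \<otimes>\<^bsub>L\<^esub> \<beta> (dn x)) \<otimes>\<^bsub>L\<^esub> \<beta> b" using nd[OF x] ab(2) by simp
    also have "\<dots> = (x \<otimes>\<^bsub>L\<^esub> \<beta> b) \<otimes>\<^bsub>L\<^esub> \<beta> (dn x)" using n ab(2) x by (simp add: L.m_ac)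
    also have "\<dots> = \<beta> (a \<otimes>\<^bsub>B\<^esub> dn x)" unfolding ab(3) using n ab by simp
    finally have e: "nm x \<otimes>\<^bsub>B\<^esub> b = a \<otimes>\<^bsub>B\<^esub> dn x" using inj n ab by (simp add: inj_on_def)
    have "(\<psi> x \<otimes>\<^bsub>K\<^esub> f b) \<otimes>\<^bsub>K\<^esub> f (dn x) = (\<psi> x \<otimes>\<^bsub>K\<^esub> f (dn x)) \<otimes>\<^bsub>K\<^esub> f b"
      using n ab(2) closed[OF x] by (simp add: K.m_ac)
    also have "\<dots> = f (nm x \<otimes>\<^bsub>B\<^esub> b)" using nd'[OF x] n ab by simp
    also have "\<dots> = f a \<otimes>\<^bsub>K\<^esub> f (dn x)" unfolding e using n ab by simp
    finally show ?thesis
      using K.Units_r_cancel[OF units[of "dn x"]] nd[OF x] ab closed[OF x] by simp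
  qed
  \<comment> \<open>Any fraction representing \<open>x\<close> determines \<psi> at \<open>x\<close>
    as the unique solution of a linear equation. Additivity and multiplicativity follow by solving
    it over the common denominator \<open>dn x \<otimes> dn y\<close>.\<close>
  have eq: "\<psi> x = y"
    if "x \<in> carrier L" "a \<in> carrier B" "b \<in> carrier B" "b \<noteq> \<zero>\<^bsub>B\<^esub>" "x \<otimes>\<^bsub>L\<^esub> \<beta> b = \<beta> a"
      "y \<in> carrier K" "y \<otimes>\<^bsub>K\<^esub> f b = f a" for x y a b
    using eval[of x a b] K.Units_r_cancel[OF units[of b]] that closed by metis
  show ?thesis
  proof (rule that)
    have \<psi>f: "\<psi> (\<beta> b) = f b" if "b \<in> carrier B" for b
      by (rule eq[of _ b "\<one>\<^bsub>B\<^esub>"]) (use that in auto)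
    then show "\<psi> (\<beta> b) = f b" if "b \<in> carrier B" for b using that .
    show "\<psi> \<in> ring_hom L K"
    proof (rule ring_hom_memI)
      show "\<psi> \<one>\<^bsub>L\<^esub> = \<one>\<^bsub>K\<^esub>" using \<psi>f[of "\<one>\<^bsub>B\<^esub>"] by simp
    next
      fix x y assume xy: "x \<in> carrier L" "y \<in> carrier L"
      note x = nd[OF xy(1)] and y = nd[OF xy(2)]
      have d: "dn x \<in> carrier B" "dn y \<in> carrier B" using x y by auto
      have "(x \<otimes>\<^bsub>L\<^esub> y) \<otimes>\<^bsub>L\<^esub> \<beta> (dn x \<otimes>\<^bsub>B\<^esub> dn y) = (x \<otimes>\<^bsub>L\<^esub> \<beta> (dn x)) \<otimes>\<^bsub>L\<^esub> (y \<otimes>\<^bsub>L\<^esub> \<beta> (dn y))"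
        using d xy by (simp add: L.m_ac)
      also have "\<dots> = \<beta> (nm x \<otimes>\<^bsub>B\<^esub> nm y)" using x y by simp
      finally have L: "(x \<otimes>\<^bsub>L\<^esub> y) \<otimes>\<^bsub>L\<^esub> \<beta> (dn x \<otimes>\<^bsub>B\<^esub> dn y) = \<beta> (nm x \<otimes>\<^bsub>B\<^esub> nm y)" .
      have "(\<psi> x \<otimes>\<^bsub>K\<^esub> \<psi> y) \<otimes>\<^bsub>K\<^esub> f (dn x \<otimes>\<^bsub>B\<^esub> dn y) = (\<psi> x \<otimes>\<^bsub>K\<^esub> f (dn x)) \<otimes>\<^bsub>K\<^esub> (\<psi> y \<otimes>\<^bsub>K\<^esub> f (dn y))"
        using d closed[OF xy(1)] closed[OF xy(2)] by (simp add: K.m_ac)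
      also have "\<dots> = f (nm x \<otimes>\<^bsub>B\<^esub> nm y)" using nd'[OF xy(1)] nd'[OF xy(2)] x y by simp
      finally have K: "(\<psi> x \<otimes>\<^bsub>K\<^esub> \<psi> y) \<otimes>\<^bsub>K\<^esub> f (dn x \<otimes>\<^bsub>B\<^esub> dn y) = f (nm x \<otimes>\<^bsub>B\<^esub> nm y)" .
      show "\<psi> (x \<otimes>\<^bsub>L\<^esub> y) = \<psi> x \<otimes>\<^bsub>K\<^esub> \<psi> y"
        using x y xy closed by (intro eq[OF _ _ _ _ L _ K]) (auto simp: B.integral_iff)
      have "(x \<oplus>\<^bsub>L\<^esub> y) \<otimes>\<^bsub>L\<^esub> \<beta> (dn x \<otimes>\<^bsub>B\<^esub> dn y)
          = (x \<otimes>\<^bsub>L\<^esub> \<beta> (dn x)) \<otimes>\<^bsub>L\<^esub> \<beta> (dn y) \<oplus>\<^bsub>L\<^esub> (y \<otimes>\<^bsub>L\<^esub> \<beta> (dn y)) \<otimes>\<^bsub>L\<^esub> \<beta> (dn x)"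
        using d xy by (simp add: L.l_distr L.r_distr L.m_ac)
      also have "\<dots> = \<beta> (nm x \<otimes>\<^bsub>B\<^esub> dn y \<oplus>\<^bsub>B\<^esub> nm y \<otimes>\<^bsub>B\<^esub> dn x)" using x y by simp
      finally have L: "(x \<oplus>\<^bsub>L\<^esub> y) \<otimes>\<^bsub>L\<^esub> \<beta> (dn x \<otimes>\<^bsub>B\<^esub> dn y) = \<beta> (nm x \<otimes>\<^bsub>B\<^esub> dn y \<oplus>\<^bsub>B\<^esub> nm y \<otimes>\<^bsub>B\<^esub> dn x)" .
      have "(\<psi> x \<oplus>\<^bsub>K\<^esub> \<psi> y) \<otimes>\<^bsub>K\<^esub> f (dn x \<otimes>\<^bsub>B\<^esub> dn y)
          = (\<psi> x \<otimes>\<^bsub>K\<^esub> f (dn x)) \<otimes>\<^bsub>K\<^esub> f (dn y) \<oplus>\<^bsub>K\<^esub> (\<psi> y \<otimes>\<^bsub>K\<^esub> f (dn y)) \<otimes>\<^bsub>K\<^esub> f (dn x)"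
        using d closed[OF xy(1)] closed[OF xy(2)] by (simp add: K.l_distr K.r_distr K.m_ac)
      also have "\<dots> = f (nm x \<otimes>\<^bsub>B\<^esub> dn y \<oplus>\<^bsub>B\<^esub> nm y \<otimes>\<^bsub>B\<^esub> dn x)"
        using nd'[OF xy(1)] nd'[OF xy(2)] x y by simp
      finally have K: "(\<psi> x \<oplus>\<^bsub>K\<^esub> \<psi> y) \<otimes>\<^bsub>K\<^esub> f (dn x \<otimes>\<^bsub>B\<^esub> dn y) = f (nm x \<otimes>\<^bsub>B\<^esub> dn y \<oplus>\<^bsub>B\<^esub> nm y \<otimes>\<^bsub>B\<^esub> dn x)" .
      show "\<psi> (x \<oplus>\<^bsub>L\<^esub> y) = \<psi> x \<oplus>\<^bsub>K\<^esub> \<psi> y"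
        using x y xy closed by (intro eq[OF _ _ _ _ L _ K]) (auto simp: B.integral_iff)
    qed (rule closed)
  qed
qed

section \<open>The universal property of the tensor product\<close>

text \<open>The supports of x, y and x + y differ. Summing over a common finite superset makes the
  three sums comparable, which is what additivity of \<open>tensor_map\<close> needs.\<close>

lemma (in cring) tensor_map_finsum:
  assumes ij: "i \<in> A \<rightarrow> carrier R" "j \<in> B \<rightarrow> carrier R"
    and S: "finite S" "Poly_Mapping.keys x \<subseteq> S" "S \<subseteq> A \<times> B"
  shows "tensor_map R i j x =
    (\<Oplus>p\<in>S. [Poly_Mapping.lookup x p] \<cdot> (i (fst p) \<otimes> j (snd p)))"
proof -
  have "i (fst p) \<otimes> j (snd p) \<in> carrier R" if "p \<in> S" for p
    using ij S(3) that by (auto simp: Pi_iff)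
  then show ?thesis
    unfolding tensor_map_def using S(1,2)
    by (intro add.finprod_mono_neutral_cong_left) (auto simp: in_keys_iff, simp add: add_pow_def)
qed

lemma (in cring) tensor_map_hom:
  assumes ij: "i \<in> A \<rightarrow> carrier R" "j \<in> B \<rightarrow> carrier R"
  shows "tensor_map R i j \<in> hom (free_Abelian_group (A \<times> B)) (add_monoid R)"
proof (rule homI)
  fix x assume "x \<in> carrier (free_Abelian_group (A \<times> B))"
  then show "tensor_map R i j x \<in> carrier (add_monoid R)"
    using ij by (auto 0 3 simp: tensor_map_def intro!: finsum_closed add.int_pow_closed m_closed)
next
  fix x y
  assume xy: "x \<in> carrier (free_Abelian_group (A \<times> B))" "y \<in> carrier (free_Abelian_group (A \<times> B))"
  let ?S = "Poly_Mapping.keys x \<union> Poly_Mapping.keys y"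
  have S: "?S \<subseteq> A \<times> B" using xy by simp
  have pure: "i (fst p) \<otimes> j (snd p) \<in> carrier R" if "p \<in> A \<times> B" for p
    using ij that by (auto simp: Pi_iff)
  note * = tensor_map_finsum[OF ij _ _ S]
  have "(\<Oplus>p\<in>?S. [Poly_Mapping.lookup (x + y) p] \<cdot> (i (fst p) \<otimes> j (snd p))) =
    (\<Oplus>p\<in>?S. [Poly_Mapping.lookup x p] \<cdot> (i (fst p) \<otimes> j (snd p)) \<oplus>
       [Poly_Mapping.lookup y p] \<cdot> (i (fst p) \<otimes> j (snd p)))"
    using pure S by (intro finsum_cong') (auto simp: lookup_add add.int_pow_mult)
  also have "\<dots> = (\<Oplus>p\<in>?S. [Poly_Mapping.lookup x p] \<cdot> (i (fst p) \<otimes> j (snd p))) \<oplus>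
      (\<Oplus>p\<in>?S. [Poly_Mapping.lookup y p] \<cdot> (i (fst p) \<otimes> j (snd p)))"
    using pure S by (intro finsum_addf) auto
  finally show "tensor_map R i j (x \<otimes>\<^bsub>free_Abelian_group (A \<times> B)\<^esub> y) =
      tensor_map R i j x \<otimes>\<^bsub>add_monoid R\<^esub> tensor_map R i j y"
    using keys_add[of x y] by (simp add: *)
qed

lemma (in cring) tensor_map_frag_of:
  assumes "i a \<in> carrier R" "j b \<in> carrier R"
  shows "tensor_map R i j (frag_of (a, b)) = i a \<otimes> j b"
proof -
  have "(\<Oplus>p\<in>{(a, b)}. [Poly_Mapping.lookup (frag_of (a, b)) p] \<cdot> (i (fst p) \<otimes> j (snd p))) = i a \<otimes> j b"
    using assms by (simp add: finsum_insert)
  then show ?thesis by (simp add: tensor_map_def)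
qed

text \<open>Every element is the image of a formal combination of pairs. Closure under differences
  accounts for both sums and negatives.\<close>

lemma tensor_product_induct [consumes 2, case_names pure zero diff]:
  assumes "is_tensor_product k A f B g T i j" "t \<in> carrier T"
    and pure: "\<And>a b. a \<in> carrier A \<Longrightarrow> b \<in> carrier B \<Longrightarrow> P (i a \<otimes>\<^bsub>T\<^esub> j b)"
    and zero: "P \<zero>\<^bsub>T\<^esub>"
    and diff: "\<And>s t. s \<in> carrier T \<Longrightarrow> t \<in> carrier T \<Longrightarrow> P s \<Longrightarrow> P t \<Longrightarrow> P (s \<ominus>\<^bsub>T\<^esub> t)"
  shows "P t"
proof -
  interpret T: cring T using assms(1) by (simp add: is_tensor_product_def Let_def)
  let ?F = "free_Abelian_group (carrier A \<times> carrier B)"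
  have ij: "i \<in> carrier A \<rightarrow> carrier T" "j \<in> carrier B \<rightarrow> carrier T"
    using assms(1) by (auto simp: is_tensor_product_def Let_def ring_hom_def)
  interpret h: group_hom ?F "add_monoid T" "tensor_map T i j"
    using T.tensor_map_hom[OF ij] T.add.group_axioms by (intro group_hom.intro group_hom_axioms.intro) auto
  obtain x where x: "Poly_Mapping.keys x \<subseteq> carrier A \<times> carrier B" "t = tensor_map T i j x"
  proof -
    have "t \<in> tensor_map T i j ` carrier ?F"
      using assms(1,2) by (simp add: is_tensor_product_def Let_def)
    then show ?thesis using that by auto
  qed
  have "P (tensor_map T i j x)"
  proof (rule free_Abelian_group_induct[OF x(1)])
    show "P (tensor_map T i j 0)" using h.hom_one zero by simp
  next
    fix x y assume 2: "Poly_Mapping.keys x \<subseteq> carrier A \<times> carrier B"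
      "Poly_Mapping.keys y \<subseteq> carrier A \<times> carrier B" "P (tensor_map T i j x)" "P (tensor_map T i j y)"
    have "tensor_map T i j (x - y) = tensor_map T i j x \<ominus>\<^bsub>T\<^esub> tensor_map T i j y"
      using h.hom_mult[of x "- y"] h.hom_inv[of y] 2(1,2)
      by (simp add: a_minus_def a_inv_def)
    then show "P (tensor_map T i j (x - y))"
      using 2 diff h.hom_closed[of x] h.hom_closed[of y] by simp
  next
    fix p assume "p \<in> carrier A \<times> carrier B"
    then show "P (tensor_map T i j (frag_of p))" using T.tensor_map_frag_of[of i _ j] ij pure by (auto simp: Pi_iff)
  qed
  then show ?thesis using x by simp
qed

text \<open>This is the third family of relations at the pair of units.\<close>

lemma tensor_product_balanced:
  assumes tp: "is_tensor_product k A f B g T i j" and "ring A" "ring B"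
    and c: "c \<in> carrier k" "f c \<in> carrier A" "g c \<in> carrier B"
  shows "i (f c) = j (g c)"
proof -
  interpret A: ring A by fact
  interpret B: ring B by fact
  interpret T: cring T using assms(1) by (simp add: is_tensor_product_def Let_def)
  let ?F = "free_Abelian_group (carrier A \<times> carrier B)"
  have ij: "i \<in> ring_hom A T" "j \<in> ring_hom B T"
    using tp by (auto simp: is_tensor_product_def Let_def)
  have ij': "i \<in> carrier A \<rightarrow> carrier T" "j \<in> carrier B \<rightarrow> carrier T"
    using ij by (auto simp: ring_hom_def)
  interpret h: group_hom ?F "add_monoid T" "tensor_map T i j"
    using T.tensor_map_hom[OF ij'] T.add.group_axioms by (intro group_hom.intro group_hom_axioms.intro) auto
  let ?x = "frag_of (f c \<otimes>\<^bsub>A\<^esub> \<one>\<^bsub>A\<^esub>, \<one>\<^bsub>B\<^esub>)" and ?y = "frag_of (\<one>\<^bsub>A\<^esub>, g c \<otimes>\<^bsub>B\<^esub> \<one>\<^bsub>B\<^esub>)"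
  have "?x - ?y \<in> tensor_relations k A f B g"
    using c(1) unfolding tensor_relations_def by blast
  then have "?x - ?y \<in> generate ?F (tensor_relations k A f B g)"
    by (rule generate.incl)
  then have "tensor_map T i j (?x - ?y) = \<zero>\<^bsub>T\<^esub>"
    using tp by (auto simp: is_tensor_product_def Let_def)
  moreover have "tensor_map T i j (?x - ?y) = tensor_map T i j ?x \<ominus>\<^bsub>T\<^esub> tensor_map T i j ?y"
    using h.hom_mult[of ?x "- ?y"] h.hom_inv[of ?y] c
    by (simp add: a_minus_def a_inv_def)
  moreover have "tensor_map T i j ?x = i (f c)" "tensor_map T i j ?y = j (g c)"
    using T.tensor_map_frag_of[of i _ j] ij' c ring_hom_one[OF ij(1)] ring_hom_one[OF ij(2)]
    by (auto simp: Pi_iff)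
  ultimately have "i (f c) \<ominus>\<^bsub>T\<^esub> j (g c) = \<zero>\<^bsub>T\<^esub>" by simp
  then show ?thesis using ij' c by (auto simp: Pi_iff)
qed

text \<open>The map \<open>tensor_map K p q\<close> kills the bilinear relations, and these generate
  the kernel of \<open>tensor_map T i j\<close>. So it descends to an additive map on
  \<open>T\<close>; its multiplicativity is a separate matter, decided on pure tensors.\<close>

lemma tensor_product_universal:
  assumes tp: "is_tensor_product k A f B g T i j"
    and "ring A" "ring B" and f: "f \<in> carrier k \<rightarrow> carrier A" and g: "g \<in> carrier k \<rightarrow> carrier B"
    and "cring K" and p: "p \<in> ring_hom A K" and q: "q \<in> ring_hom B K"
    and pq: "\<And>c. c \<in> carrier k \<Longrightarrow> p (f c) = q (g c)"
  obtains u where "u \<in> ring_hom T K" "\<And>a. a \<in> carrier A \<Longrightarrow> u (i a) = p a"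
    "\<And>b. b \<in> carrier B \<Longrightarrow> u (j b) = q b"
proof -
  interpret A: ring A by fact
  interpret B: ring B by fact
  interpret K: cring K by fact
  interpret T: cring T using assms(1) by (simp add: is_tensor_product_def Let_def)
  let ?F = "free_Abelian_group (carrier A \<times> carrier B)"
  have i: "i \<in> ring_hom A T" and j: "j \<in> ring_hom B T"
    and surj: "tensor_map T i j ` carrier ?F = carrier T"
    and ker: "{x \<in> carrier ?F. tensor_map T i j x = \<zero>\<^bsub>T\<^esub>} = generate ?F (tensor_relations k A f B g)"
    using tp by (auto simp: is_tensor_product_def Let_def)
  have ij': "i \<in> carrier A \<rightarrow> carrier T" "j \<in> carrier B \<rightarrow> carrier T"
    and pq': "p \<in> carrier A \<rightarrow> carrier K" "q \<in> carrier B \<rightarrow> carrier K"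
    using i j p q by (auto simp: ring_hom_def)
  interpret i: ring_hom_ring A T i by (intro ring_hom_ringI2 A.ring_axioms T.ring_axioms i)
  interpret j: ring_hom_ring B T j by (intro ring_hom_ringI2 B.ring_axioms T.ring_axioms j)
  interpret p: ring_hom_ring A K p by (intro ring_hom_ringI2 A.ring_axioms K.ring_axioms p)
  interpret q: ring_hom_ring B K q by (intro ring_hom_ringI2 B.ring_axioms K.ring_axioms q)
  interpret h: group_hom ?F "add_monoid T" "tensor_map T i j"
    using T.tensor_map_hom[OF ij'] T.add.group_axioms by (intro group_hom.intro group_hom_axioms.intro) auto
  interpret w: group_hom ?F "add_monoid K" "tensor_map K p q"
    using K.tensor_map_hom[OF pq'] K.add.group_axioms by (intro group_hom.intro group_hom_axioms.intro) auto
  have h_diff: "tensor_map T i j (x - y) = tensor_map T i j x \<ominus>\<^bsub>T\<^esub> tensor_map T i j y"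
    if "x \<in> carrier ?F" "y \<in> carrier ?F" for x y
    using h.hom_mult[of x "- y"] h.hom_inv[of y] that by (simp add: a_minus_def a_inv_def)
  have w_diff: "tensor_map K p q (x - y) = tensor_map K p q x \<ominus>\<^bsub>K\<^esub> tensor_map K p q y"
    if "x \<in> carrier ?F" "y \<in> carrier ?F" for x y
    using w.hom_mult[of x "- y"] w.hom_inv[of y] that by (simp add: a_minus_def a_inv_def)
  have h_closed: "tensor_map T i j x \<in> carrier T" and w_closed: "tensor_map K p q x \<in> carrier K"
    if "x \<in> carrier ?F" for x
    using h.hom_closed[OF that] w.hom_closed[OF that] by simp_all
  have diff_closed: "x - y \<in> carrier ?F" if "x \<in> carrier ?F" "y \<in> carrier ?F" for x y
    using that keys_diff[of x y] by auto
  have w_frag: "tensor_map K p q (frag_of (a, b)) = p a \<otimes>\<^bsub>K\<^esub> q b"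
    if "a \<in> carrier A" "b \<in> carrier B" for a b
    using K.tensor_map_frag_of[of p a q b] that by simp
  have h_frag: "tensor_map T i j (frag_of (a, b)) = i a \<otimes>\<^bsub>T\<^esub> j b"
    if "a \<in> carrier A" "b \<in> carrier B" for a b
    using T.tensor_map_frag_of[of i a j b] that by simp
  have rel: "tensor_relations k A f B g \<subseteq> kernel ?F (add_monoid K) (tensor_map K p q)"
  proof -
    have fc: "f c \<in> carrier A" "g c \<in> carrier B" if "c \<in> carrier k" for c using f g that by auto
    have fr: "frag_of (a, b) \<in> carrier ?F" if "a \<in> carrier A" "b \<in> carrier B" for a b
      using that by simp
    have "tensor_map K p q (frag_of (a \<oplus>\<^bsub>A\<^esub> a', b) - frag_of (a, b) - frag_of (a', b)) = \<zero>\<^bsub>K\<^esub>"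
      if "a \<in> carrier A" "a' \<in> carrier A" "b \<in> carrier B" for a a' b
    proof -
      have "(p a \<oplus>\<^bsub>K\<^esub> p a') \<otimes>\<^bsub>K\<^esub> q b \<ominus>\<^bsub>K\<^esub> p a \<otimes>\<^bsub>K\<^esub> q b \<ominus>\<^bsub>K\<^esub> p a' \<otimes>\<^bsub>K\<^esub> q b = \<zero>\<^bsub>K\<^esub>"
        using p.hom_closed[OF that(1)] p.hom_closed[OF that(2)] q.hom_closed[OF that(3)] by algebra
      then show ?thesis using that
        by (simp only: w_diff diff_closed fr w_frag A.a_closed p.hom_add)
    qed
    moreover have "tensor_map K p q (frag_of (a, b \<oplus>\<^bsub>B\<^esub> b') - frag_of (a, b) - frag_of (a, b')) = \<zero>\<^bsub>K\<^esub>"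
      if "a \<in> carrier A" "b \<in> carrier B" "b' \<in> carrier B" for a b b'
    proof -
      have "p a \<otimes>\<^bsub>K\<^esub> (q b \<oplus>\<^bsub>K\<^esub> q b') \<ominus>\<^bsub>K\<^esub> p a \<otimes>\<^bsub>K\<^esub> q b \<ominus>\<^bsub>K\<^esub> p a \<otimes>\<^bsub>K\<^esub> q b' = \<zero>\<^bsub>K\<^esub>"
        using p.hom_closed[OF that(1)] q.hom_closed[OF that(2)] q.hom_closed[OF that(3)] by algebra
      then show ?thesis using that
        by (simp only: w_diff diff_closed fr w_frag B.a_closed q.hom_add)
    qed
    moreover have "tensor_map K p q (frag_of (f c \<otimes>\<^bsub>A\<^esub> a, b) - frag_of (a, g c \<otimes>\<^bsub>B\<^esub> b)) = \<zero>\<^bsub>K\<^esub>"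
      if "a \<in> carrier A" "b \<in> carrier B" "c \<in> carrier k" for a b c
    proof -
      have "(q (g c) \<otimes>\<^bsub>K\<^esub> p a) \<otimes>\<^bsub>K\<^esub> q b \<ominus>\<^bsub>K\<^esub> p a \<otimes>\<^bsub>K\<^esub> (q (g c) \<otimes>\<^bsub>K\<^esub> q b) = \<zero>\<^bsub>K\<^esub>"
        using p.hom_closed[OF that(1)] q.hom_closed[OF that(2)] q.hom_closed[OF fc(2)[OF that(3)]] by algebra
      then show ?thesis using that
        by (simp only: w_diff diff_closed fr fc w_frag A.m_closed B.m_closed p.hom_mult q.hom_mult pq)
    qed
    ultimately have "tensor_map K p q x = \<zero>\<^bsub>K\<^esub>" if "x \<in> tensor_relations k A f B g" for x
      using that unfolding tensor_relations_def by fast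
    moreover have "tensor_relations k A f B g \<subseteq> carrier ?F"
      unfolding tensor_relations_def using fc
      by (auto simp del: carrier_free_Abelian_group_iff frag_of_in_free_Abelian_group
          intro!: diff_closed fr A.m_closed B.m_closed A.a_closed B.a_closed)
    ultimately show ?thesis
      unfolding kernel_def by (auto simp del: carrier_free_Abelian_group_iff)
  qed
  have ker_le: "tensor_map K p q x = \<zero>\<^bsub>K\<^esub>" if "x \<in> carrier ?F" "tensor_map T i j x = \<zero>\<^bsub>T\<^esub>" for x
  proof -
    have "generate ?F (tensor_relations k A f B g) \<subseteq> kernel ?F (add_monoid K) (tensor_map K p q)"
      by (rule group.generate_subgroup_incl[OF _ rel w.subgroup_kernel]) simp
    then show ?thesis using that ker by (auto simp: kernel_def)
  qed
  \<comment> \<open>A preimage is picked by choice. Two preimages differ by an element of the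
    kernel, which \<open>ker_le\<close> sends to zero.\<close>
  define u where "u t = tensor_map K p q (SOME x. x \<in> carrier ?F \<and> tensor_map T i j x = t)" for t
  have u: "u (tensor_map T i j x) = tensor_map K p q x" if x: "x \<in> carrier ?F" for x
  proof -
    define y where "y = (SOME y. y \<in> carrier ?F \<and> tensor_map T i j y = tensor_map T i j x)"
    have y: "y \<in> carrier ?F" "tensor_map T i j y = tensor_map T i j x"
      using someI_ex[of "\<lambda>y. y \<in> carrier ?F \<and> tensor_map T i j y = tensor_map T i j x"] x
      unfolding y_def by blast+
    have "tensor_map T i j (y - x) = \<zero>\<^bsub>T\<^esub>"
      using h_diff[OF y(1) x] y(2) h_closed[OF x] by simp
    then have "tensor_map K p q y \<ominus>\<^bsub>K\<^esub> tensor_map K p q x = \<zero>\<^bsub>K\<^esub>"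
      using ker_le[OF diff_closed[OF y(1) x]] w_diff[OF y(1) x] by simp
    then show ?thesis using w_closed[OF x] w_closed[OF y(1)]
      by (simp add: u_def del: carrier_free_Abelian_group_iff flip: y_def)
  qed
  have u_closed: "u t \<in> carrier K" if "t \<in> carrier T" for t
    using that u w_closed unfolding surj[symmetric] by force
  have u_pure: "u (i a \<otimes>\<^bsub>T\<^esub> j b) = p a \<otimes>\<^bsub>K\<^esub> q b" if "a \<in> carrier A" "b \<in> carrier B" for a b
    using u[of "frag_of (a, b)"] that by (simp add: w_frag h_frag)
  have u_diff: "u (s \<ominus>\<^bsub>T\<^esub> t) = u s \<ominus>\<^bsub>K\<^esub> u t" if st: "s \<in> carrier T" "t \<in> carrier T" for s t
  proof -
    obtain x y where xy: "x \<in> carrier ?F" "y \<in> carrier ?F"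
      and eq: "s = tensor_map T i j x" "t = tensor_map T i j y"
      using st unfolding surj[symmetric] by blast
    show ?thesis
      unfolding eq by (simp only: xy diff_closed u flip: h_diff w_diff)
  qed
  have u_zero: "u \<zero>\<^bsub>T\<^esub> = \<zero>\<^bsub>K\<^esub>"
    using u_diff[of "\<zero>\<^bsub>T\<^esub>" "\<zero>\<^bsub>T\<^esub>"] u_closed[of "\<zero>\<^bsub>T\<^esub>"] by (simp add: K.r_neg a_minus_def)
  have u_minus: "u (\<ominus>\<^bsub>T\<^esub> t) = \<ominus>\<^bsub>K\<^esub> u t" if "t \<in> carrier T" for t
    using u_diff[of "\<zero>\<^bsub>T\<^esub>" t] u_zero u_closed[OF that] that by (simp add: a_minus_def)
  have u_add: "u (s \<oplus>\<^bsub>T\<^esub> t) = u s \<oplus>\<^bsub>K\<^esub> u t" if st: "s \<in> carrier T" "t \<in> carrier T" for s t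
    using u_diff[of s "\<ominus>\<^bsub>T\<^esub> t"] u_minus[of t] u_closed st by (simp add: a_minus_def)
  \<comment> \<open>Multiplicativity takes two inductions: over the left factor with the right one
    pure, then over the right factor.\<close>
  have mult_pure: "u (t \<otimes>\<^bsub>T\<^esub> (i a \<otimes>\<^bsub>T\<^esub> j b)) = u t \<otimes>\<^bsub>K\<^esub> (p a \<otimes>\<^bsub>K\<^esub> q b)"
    if t: "t \<in> carrier T" and ab: "a \<in> carrier A" "b \<in> carrier B" for t a b
    using tp t
  proof (induction rule: tensor_product_induct)
    case (pure a' b')
    have eq: "(i a' \<otimes>\<^bsub>T\<^esub> j b') \<otimes>\<^bsub>T\<^esub> (i a \<otimes>\<^bsub>T\<^esub> j b) = i (a' \<otimes>\<^bsub>A\<^esub> a) \<otimes>\<^bsub>T\<^esub> j (b' \<otimes>\<^bsub>B\<^esub> b)"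
      using pure ab by (simp add: T.m_ac)
    show ?case
      unfolding eq using u_pure[of "a' \<otimes>\<^bsub>A\<^esub> a" "b' \<otimes>\<^bsub>B\<^esub> b"] u_pure[of a' b'] pure ab
      by (simp add: K.m_ac)
  next
    case zero
    show ?case using ab u_zero by simp
  next
    case (diff s t)
    then show ?case using ab u_closed
      by (simp add: u_diff u_add u_minus a_minus_def T.l_distr K.l_distr T.l_minus K.l_minus)
  qed
  have u_mult: "u (t \<otimes>\<^bsub>T\<^esub> s) = u t \<otimes>\<^bsub>K\<^esub> u s" if t: "t \<in> carrier T" and s: "s \<in> carrier T" for s t
    using tp s
  proof (induction rule: tensor_product_induct)
    case (pure a b)
    then show ?case using mult_pure[OF t] by (simp add: u_pure)
  next
    case zero
    show ?case using t u_closed u_zero by simp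
  next
    case (diff s s')
    then show ?case using t u_closed
      by (simp add: u_diff u_add u_minus a_minus_def T.r_distr K.r_distr T.r_minus K.r_minus)
  qed
  have u_one: "u \<one>\<^bsub>T\<^esub> = \<one>\<^bsub>K\<^esub>"
    using u_pure[of "\<one>\<^bsub>A\<^esub>" "\<one>\<^bsub>B\<^esub>"] by simp
  show ?thesis
  proof (rule that)
    show "u \<in> ring_hom T K"
      using u_closed u_add u_mult u_one by (intro ring_hom_memI)
    show "u (i a) = p a" if "a \<in> carrier A" for a
      using u_pure[of a "\<one>\<^bsub>B\<^esub>"] that by simp
    show "u (j b) = q b" if "b \<in> carrier B" for b
      using u_pure[of "\<one>\<^bsub>A\<^esub>" b] that by simp
  qed
qed

section \<open>Bidifferential primes under localization\<close>

locale bidifferential_cring = cring R for R :: "('a, 'm) biring_scheme" (structure) +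
  assumes bidifferential: "bidifferential_ring R"
begin

lemma bracket_closed [simp]:
  "a \<in> carrier R \<Longrightarrow> b \<in> carrier R \<Longrightarrow> bracket R a b \<in> carrier R"
  and bracket_add_left:
  "a \<in> carrier R \<Longrightarrow> b \<in> carrier R \<Longrightarrow> c \<in> carrier R \<Longrightarrow>
    bracket R (a \<oplus> b) c = bracket R a c \<oplus> bracket R b c"
  and bracket_add_right:
  "a \<in> carrier R \<Longrightarrow> b \<in> carrier R \<Longrightarrow> c \<in> carrier R \<Longrightarrow>
    bracket R c (a \<oplus> b) = bracket R c a \<oplus> bracket R c b"
  and bracket_mult_left:
  "a \<in> carrier R \<Longrightarrow> b \<in> carrier R \<Longrightarrow> c \<in> carrier R \<Longrightarrow>
    bracket R (a \<otimes> b) c = a \<otimes> bracket R b c \<oplus> bracket R a c \<otimes> b"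
  and bracket_mult_right:
  "a \<in> carrier R \<Longrightarrow> b \<in> carrier R \<Longrightarrow> c \<in> carrier R \<Longrightarrow>
    bracket R c (a \<otimes> b) = a \<otimes> bracket R c b \<oplus> bracket R c a \<otimes> b"
  using bidifferential unfolding bidifferential_ring_def derivation_def Pi_iff by blast+

end

lemma bidifferential_cringI: "bidifferential_ring R \<Longrightarrow> bidifferential_cring R"
  by (simp add: bidifferential_cring_def bidifferential_cring_axioms_def bidifferential_ring_def)

definition bidifferential_prime :: "('a, 'm) biring_scheme \<Rightarrow> 'a set \<Rightarrow> bool" where
  "bidifferential_prime R P \<longleftrightarrow> primeideal P R \<and> bidifferential_ideal R P"

definition bidifferential_core :: "('a, 'm) biring_scheme \<Rightarrow> 'a set" where
  "bidifferential_core R =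
     {a \<in> carrier R. \<forall>P. bidifferential_prime R P \<longrightarrow> P \<noteq> {\<zero>\<^bsub>R\<^esub>} \<longrightarrow> a \<in> P}"

text \<open>Zero lies in every prime, so the core always contains it, and being different from the
  zero ideal means having a nonzero element.\<close>

lemma B_locally_closed_iff:
  "B_locally_closed k V \<longleftrightarrow> irreducible_B_variety k V \<and> (\<exists>a\<in>bidifferential_core V. a \<noteq> \<zero>\<^bsub>V\<^esub>)"
proof -
  have *: "{a \<in> carrier V. \<forall>P. primeideal P V \<longrightarrow> bidifferential_ideal V P \<longrightarrow> P \<noteq> {\<zero>\<^bsub>V\<^esub>} \<longrightarrow> a \<in> P}
      = bidifferential_core V"
    unfolding bidifferential_core_def bidifferential_prime_def by blast
  have "\<zero>\<^bsub>V\<^esub> \<in> bidifferential_core V" if "irreducible_B_variety k V"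
  proof -
    have "cring V"
      using that by (simp add: irreducible_B_variety_def B_variety_def bidifferential_ring_def)
    then show ?thesis
      unfolding bidifferential_core_def bidifferential_prime_def
      by (auto simp: additive_subgroup.zero_closed ideal_def primeideal_def cring.cring_simprules)
  qed
  then show ?thesis unfolding B_locally_closed_def * by blast
qed

lemma bidifferential_prime_vimage:
  assumes "bidifferential_ring R" and h: "h \<in> bidifferential_hom R S" and P: "bidifferential_prime S P"
  shows "bidifferential_prime R {a \<in> carrier R. h a \<in> P}"
proof -
  interpret R: bidifferential_cring R using assms(1) by (rule bidifferential_cringI)
  interpret P: primeideal P S using P by (simp add: bidifferential_prime_def)
  interpret h: ring_hom_ring R S h
    using h by (intro ring_hom_ringI2 R.ring_axioms P.ring_axioms) (simp add: bidifferential_hom_def)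
  let ?Q = "{a \<in> carrier R. h a \<in> P}"
  have id: "ideal ?Q R"
  proof (rule idealI[OF R.ring_axioms])
    show "subgroup ?Q (add_monoid R)"
      by (rule R.add.subgroupI) (auto simp: P.a_closed P.a_inv_closed P.zero_closed)
  qed (auto simp: P.I_l_closed P.I_r_closed)
  have "primeideal ?Q R"
  proof (rule primeidealI[OF id R.is_cring])
    have "h \<one>\<^bsub>R\<^esub> \<notin> P" using P.I_notcarr P.one_imp_carrier by auto
    then show "carrier R \<noteq> ?Q" using R.one_closed by blast
  qed (use P.I_prime in auto)
  moreover have "bidifferential_ideal R ?Q"
    using id h P unfolding bidifferential_ideal_def bidifferential_prime_def bidifferential_hom_def
    by auto
  ultimately show ?thesis by (simp add: bidifferential_prime_def)
qed

text \<open>An abstract description of \<open>F\<close> as the localization of \<open>A\<close> at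
  the nonzero elements of \<open>B\<close>. The fibre ring arises as a quotient of a tensor product,
  so it can only satisfy such a description, not be a localization by construction.\<close>

locale bidifferential_localization =
  fixes A :: "('a, 'm) biring_scheme" and B :: "('b, 'n) biring_scheme"
    and F :: "('f, 'p) biring_scheme" and \<phi> :: "'b \<Rightarrow> 'a" and \<pi> :: "'a \<Rightarrow> 'f"
  assumes A: "bidifferential_ring A" "domain A" and B: "bidifferential_ring B" "domain B"
    and F: "bidifferential_ring F" "domain F"
    and \<phi>: "\<phi> \<in> bidifferential_hom B A" and \<pi>: "\<pi> \<in> bidifferential_hom A F" "inj_on \<pi> (carrier A)"
    and units: "\<And>b. b \<in> carrier B \<Longrightarrow> b \<noteq> \<zero>\<^bsub>B\<^esub> \<Longrightarrow> \<pi> (\<phi> b) \<in> Units F"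
    and frac: "\<And>f. f \<in> carrier F \<Longrightarrow>
      \<exists>a\<in>carrier A. \<exists>b\<in>carrier B. b \<noteq> \<zero>\<^bsub>B\<^esub> \<and> f \<otimes>\<^bsub>F\<^esub> \<pi> (\<phi> b) = \<pi> a"
begin

sublocale A: bidifferential_cring A + A: domain A using A by (auto intro: bidifferential_cringI)
sublocale B: bidifferential_cring B + B: domain B using B by (auto intro: bidifferential_cringI)
sublocale F: bidifferential_cring F + F: domain F using F by (auto intro: bidifferential_cringI)
sublocale \<phi>: ring_hom_ring B A \<phi>
  using \<phi> by (intro ring_hom_ringI2 A.ring_axioms B.ring_axioms) (simp add: bidifferential_hom_def)
sublocale \<pi>: ring_hom_ring A F \<pi>
  using \<pi> by (intro ring_hom_ringI2 A.ring_axioms F.ring_axioms) (simp add: bidifferential_hom_def)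

lemma \<pi>_eq_iff: "a \<in> carrier A \<Longrightarrow> a' \<in> carrier A \<Longrightarrow> \<pi> a = \<pi> a' \<longleftrightarrow> a = a'"
  using \<pi>(2) by (auto simp: inj_on_def)

lemma \<phi>_nonzero:
  assumes "b \<in> carrier B" "b \<noteq> \<zero>\<^bsub>B\<^esub>"
  shows "\<phi> b \<noteq> \<zero>\<^bsub>A\<^esub>"
proof
  assume "\<phi> b = \<zero>\<^bsub>A\<^esub>"
  then have "\<zero>\<^bsub>F\<^esub> \<in> Units F" using units[OF assms] by simp
  from F.Units_r_inv[OF this] F.Units_inv_closed[OF this] show False by simp
qed

text \<open>The ideal generated by \<open>P\<close> in the localization, for \<open>P\<close> prime
  and disjoint from the denominators. Quantifying over all representations of \<open>f\<close> as a
  fraction avoids choosing one; \<open>mem_extension_iff\<close> then shows that any single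
  representation decides membership.\<close>

definition extension :: "'a set \<Rightarrow> 'f set" where
  "extension P = {f \<in> carrier F. \<forall>a\<in>carrier A. \<forall>b\<in>carrier B.
     b \<noteq> \<zero>\<^bsub>B\<^esub> \<longrightarrow> f \<otimes>\<^bsub>F\<^esub> \<pi> (\<phi> b) = \<pi> a \<longrightarrow> a \<in> P}"

context
  fixes P assumes P: "bidifferential_prime A P" and disjoint: "\<And>b. b \<in> carrier B \<Longrightarrow> \<phi> b \<in> P \<Longrightarrow> b = \<zero>\<^bsub>B\<^esub>"
begin

interpretation P: primeideal P A using P by (simp add: bidifferential_prime_def)

lemma mem_extension_iff:
  assumes "f \<in> carrier F" "a \<in> carrier A" "b \<in> carrier B" "b \<noteq> \<zero>\<^bsub>B\<^esub>" "f \<otimes>\<^bsub>F\<^esub> \<pi> (\<phi> b) = \<pi> a"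
  shows "f \<in> extension P \<longleftrightarrow> a \<in> P"
proof
  assume "f \<in> extension P" then show "a \<in> P" using assms by (auto simp: extension_def)
next
  assume aP: "a \<in> P"
  have "a' \<in> P" if a': "a' \<in> carrier A" "b' \<in> carrier B" "f \<otimes>\<^bsub>F\<^esub> \<pi> (\<phi> b') = \<pi> a'" for a' b'
  proof -
    have "\<pi> (a' \<otimes>\<^bsub>A\<^esub> \<phi> b) = (f \<otimes>\<^bsub>F\<^esub> \<pi> (\<phi> b')) \<otimes>\<^bsub>F\<^esub> \<pi> (\<phi> b)" using a' assms(3) by simp
    also have "\<dots> = (f \<otimes>\<^bsub>F\<^esub> \<pi> (\<phi> b)) \<otimes>\<^bsub>F\<^esub> \<pi> (\<phi> b')"
      using assms(1,3) a'(2) by (simp add: F.m_ac)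
    also have "\<dots> = \<pi> (a \<otimes>\<^bsub>A\<^esub> \<phi> b')" unfolding assms(5) using assms(2) a'(2) by simp
    finally have "a' \<otimes>\<^bsub>A\<^esub> \<phi> b = a \<otimes>\<^bsub>A\<^esub> \<phi> b'"
      using \<pi>_eq_iff[of "a' \<otimes>\<^bsub>A\<^esub> \<phi> b" "a \<otimes>\<^bsub>A\<^esub> \<phi> b'"] a' assms by simp
    then have "a' \<otimes>\<^bsub>A\<^esub> \<phi> b \<in> P" using P.I_r_closed[OF aP, of "\<phi> b'"] a' by simp
    then show ?thesis using P.I_prime[of a' "\<phi> b"] disjoint[of b] a' assms by auto
  qed
  then show "f \<in> extension P" using assms(1) by (auto simp: extension_def)
qed

lemma mem_extension_\<pi>: "a \<in> carrier A \<Longrightarrow> \<pi> a \<in> extension P \<longleftrightarrow> a \<in> P"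
  by (rule mem_extension_iff[of _ _ "\<one>\<^bsub>B\<^esub>"]) simp_all

lemma primeideal_extension: "primeideal (extension P) F"
proof -
  \<comment> \<open>The product of the numerators is a numerator of the product. The equivalence
    serves twice: from right to left it is absorption, from left to right primality.\<close>
  have mult: "f \<otimes>\<^bsub>F\<^esub> g \<in> extension P \<longleftrightarrow> f \<in> extension P \<or> g \<in> extension P"
    if fg: "f \<in> carrier F" "g \<in> carrier F" for f g
  proof -
    from frac[OF fg(1)] frac[OF fg(2)] obtain a b c d
      where ab: "a \<in> carrier A" "b \<in> carrier B" "b \<noteq> \<zero>\<^bsub>B\<^esub>" "f \<otimes>\<^bsub>F\<^esub> \<pi> (\<phi> b) = \<pi> a"
        and cd: "c \<in> carrier A" "d \<in> carrier B" "d \<noteq> \<zero>\<^bsub>B\<^esub>" "g \<otimes>\<^bsub>F\<^esub> \<pi> (\<phi> d) = \<pi> c" by blast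
    have "(f \<otimes>\<^bsub>F\<^esub> g) \<otimes>\<^bsub>F\<^esub> \<pi> (\<phi> (b \<otimes>\<^bsub>B\<^esub> d)) = (f \<otimes>\<^bsub>F\<^esub> \<pi> (\<phi> b)) \<otimes>\<^bsub>F\<^esub> (g \<otimes>\<^bsub>F\<^esub> \<pi> (\<phi> d))"
      using ab(2) cd(2) fg by (simp add: F.m_ac)
    also have "\<dots> = \<pi> (a \<otimes>\<^bsub>A\<^esub> c)" using ab cd by simp
    finally have "f \<otimes>\<^bsub>F\<^esub> g \<in> extension P \<longleftrightarrow> a \<otimes>\<^bsub>A\<^esub> c \<in> P"
      using ab(1-3) cd(1-3) fg
      by (intro mem_extension_iff[where b = "b \<otimes>\<^bsub>B\<^esub> d"]) (simp_all only: B.integral_iff A.m_closed B.m_closed F.m_closed simp_thms)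
    also have "\<dots> \<longleftrightarrow> a \<in> P \<or> c \<in> P"
      using P.I_prime P.I_l_closed P.I_r_closed ab cd by blast
    also have "\<dots> \<longleftrightarrow> f \<in> extension P \<or> g \<in> extension P"
      using mem_extension_iff fg ab cd by metis
    finally show ?thesis .
  qed
  have zero: "\<zero>\<^bsub>F\<^esub> \<in> extension P" using mem_extension_\<pi>[of "\<zero>\<^bsub>A\<^esub>"] P.zero_closed by simp
  have add: "f \<oplus>\<^bsub>F\<^esub> g \<in> extension P" if f: "f \<in> extension P" and g: "g \<in> extension P" for f g
  proof -
    have fg: "f \<in> carrier F" "g \<in> carrier F" using f g by (auto simp: extension_def)
    from frac[OF fg(1)] frac[OF fg(2)] obtain a b c d
      where ab: "a \<in> carrier A" "b \<in> carrier B" "b \<noteq> \<zero>\<^bsub>B\<^esub>" "f \<otimes>\<^bsub>F\<^esub> \<pi> (\<phi> b) = \<pi> a"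
        and cd: "c \<in> carrier A" "d \<in> carrier B" "d \<noteq> \<zero>\<^bsub>B\<^esub>" "g \<otimes>\<^bsub>F\<^esub> \<pi> (\<phi> d) = \<pi> c" by blast
    have "(f \<oplus>\<^bsub>F\<^esub> g) \<otimes>\<^bsub>F\<^esub> \<pi> (\<phi> (b \<otimes>\<^bsub>B\<^esub> d))
        = (f \<otimes>\<^bsub>F\<^esub> \<pi> (\<phi> b)) \<otimes>\<^bsub>F\<^esub> \<pi> (\<phi> d) \<oplus>\<^bsub>F\<^esub> (g \<otimes>\<^bsub>F\<^esub> \<pi> (\<phi> d)) \<otimes>\<^bsub>F\<^esub> \<pi> (\<phi> b)"
      using ab(2) cd(2) fg by (simp add: F.l_distr F.r_distr F.m_ac)
    also have "\<dots> = \<pi> (a \<otimes>\<^bsub>A\<^esub> \<phi> d \<oplus>\<^bsub>A\<^esub> c \<otimes>\<^bsub>A\<^esub> \<phi> b)" using ab cd by simp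
    finally have "f \<oplus>\<^bsub>F\<^esub> g \<in> extension P \<longleftrightarrow> a \<otimes>\<^bsub>A\<^esub> \<phi> d \<oplus>\<^bsub>A\<^esub> c \<otimes>\<^bsub>A\<^esub> \<phi> b \<in> P"
      using ab(1-3) cd(1-3) fg
      by (intro mem_extension_iff[where b = "b \<otimes>\<^bsub>B\<^esub> d"])
        (simp_all only: B.integral_iff A.m_closed B.m_closed A.a_closed F.a_closed \<phi>.hom_closed simp_thms)
    moreover have "a \<in> P" "c \<in> P"
      using mem_extension_iff[OF fg(1) ab] mem_extension_iff[OF fg(2) cd] f g by blast+
    ultimately show ?thesis using ab cd by (simp add: P.a_closed P.I_r_closed)
  qed
  have sub: "extension P \<subseteq> carrier F" by (auto simp: extension_def)
  have "ideal (extension P) F"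
  proof (rule idealI[OF F.ring_axioms])
    show "subgroup (extension P) (add_monoid F)"
    proof (rule F.add.subgroupI)
      fix f assume f: "f \<in> extension P"
      \<comment> \<open>Negation is multiplication by the negative of the unit, so
        \<open>mult\<close> covers it as well.\<close>
      then have "\<ominus>\<^bsub>F\<^esub> f = \<ominus>\<^bsub>F\<^esub> \<one>\<^bsub>F\<^esub> \<otimes>\<^bsub>F\<^esub> f" using sub by (auto simp: F.l_minus)
      then show "\<ominus>\<^bsub>F\<^esub> f \<in> extension P" using mult[of "\<ominus>\<^bsub>F\<^esub> \<one>\<^bsub>F\<^esub>" f] f sub by auto
    qed (use sub zero add in auto)
  qed (use mult sub in auto)
  then show ?thesis
  proof (rule primeidealI[OF _ F.is_cring])
    have "\<one>\<^bsub>F\<^esub> \<notin> extension P"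
      using mem_extension_\<pi>[of "\<one>\<^bsub>A\<^esub>"] P.I_notcarr P.one_imp_carrier by auto
    then show "carrier F \<noteq> extension P" using F.one_closed by blast
  qed (use mult in blast)
qed

text \<open>\<open>D\<close> stands for the bracket of \<open>F\<close> and for the bracket with its arguments swapped.\<close>

lemma bracket_extension:
  assumes D: "\<And>f g. f \<in> carrier F \<Longrightarrow> g \<in> carrier F \<Longrightarrow> D f g \<in> carrier F"
    and left: "\<And>f g r. f \<in> carrier F \<Longrightarrow> g \<in> carrier F \<Longrightarrow> r \<in> carrier F \<Longrightarrow>
      D (f \<otimes>\<^bsub>F\<^esub> g) r = f \<otimes>\<^bsub>F\<^esub> D g r \<oplus>\<^bsub>F\<^esub> D f r \<otimes>\<^bsub>F\<^esub> g"
    and right: "\<And>f g r. f \<in> carrier F \<Longrightarrow> g \<in> carrier F \<Longrightarrow> r \<in> carrier F \<Longrightarrow>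
      D r (f \<otimes>\<^bsub>F\<^esub> g) = f \<otimes>\<^bsub>F\<^esub> D r g \<oplus>\<^bsub>F\<^esub> D r f \<otimes>\<^bsub>F\<^esub> g"
    and DP: "\<And>p a. p \<in> P \<Longrightarrow> a \<in> carrier A \<Longrightarrow> D (\<pi> p) (\<pi> a) \<in> extension P"
    and f: "f \<in> extension P" and g: "g \<in> carrier F"
  shows "D f g \<in> extension P"
proof -
  interpret Q: primeideal "extension P" F by (rule primeideal_extension)
  have den: "\<pi> (\<phi> b) \<notin> extension P" if "b \<in> carrier B" "b \<noteq> \<zero>\<^bsub>B\<^esub>" for b
    using mem_extension_\<pi>[of "\<phi> b"] disjoint that by auto
  \<comment> \<open>The Leibniz rule for a product with a denominator yields a sum of this shape. If
    the sum and \<open>y\<close> are in the prime, so is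
    \<open>z \<otimes> \<pi> (\<phi> b)\<close>, and the denominator is outside by
    \<open>den\<close>.\<close>
  have cancel: "z \<in> extension P"
    if "y \<oplus>\<^bsub>F\<^esub> z \<otimes>\<^bsub>F\<^esub> \<pi> (\<phi> b) \<in> extension P" "y \<in> extension P" "z \<in> carrier F"
      "b \<in> carrier B" "b \<noteq> \<zero>\<^bsub>B\<^esub>" for y z b
  proof -
    have "z \<otimes>\<^bsub>F\<^esub> \<pi> (\<phi> b) = \<ominus>\<^bsub>F\<^esub> y \<oplus>\<^bsub>F\<^esub> (y \<oplus>\<^bsub>F\<^esub> z \<otimes>\<^bsub>F\<^esub> \<pi> (\<phi> b))"
      using that Q.Icarr by (simp add: F.r_neg1)
    also have "\<dots> \<in> extension P" using that Q.a_closed Q.a_inv_closed by simp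
    finally have "z \<otimes>\<^bsub>F\<^esub> \<pi> (\<phi> b) \<in> extension P" .
    then show ?thesis using Q.I_prime[of z "\<pi> (\<phi> b)"] den[of b] that by auto
  qed
  have fc: "f \<in> carrier F" using f Q.Icarr by simp
  from frac[OF fc] obtain a b where ab: "a \<in> carrier A" "b \<in> carrier B" "b \<noteq> \<zero>\<^bsub>B\<^esub>"
    "f \<otimes>\<^bsub>F\<^esub> \<pi> (\<phi> b) = \<pi> a" by blast
  have a: "a \<in> P" using mem_extension_iff[OF fc ab] f by blast
  \<comment> \<open>Clearing the denominator in the first argument: expand
    \<open>D (\<pi> a) (\<pi> y)\<close>, which lies in the extension by \<open>DP\<close>, along
    the equation for \<open>f\<close>.\<close>
  have num: "D f (\<pi> y) \<in> extension P" if y: "y \<in> carrier A" for y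
  proof (rule cancel[OF _ _ _ ab(2,3)])
    show "f \<otimes>\<^bsub>F\<^esub> D (\<pi> (\<phi> b)) (\<pi> y) \<oplus>\<^bsub>F\<^esub> D f (\<pi> y) \<otimes>\<^bsub>F\<^esub> \<pi> (\<phi> b) \<in> extension P"
      using DP[OF a y] left[of f "\<pi> (\<phi> b)" "\<pi> y"] fc ab y by simp
    show "f \<otimes>\<^bsub>F\<^esub> D (\<pi> (\<phi> b)) (\<pi> y) \<in> extension P" using Q.I_r_closed[OF f] D ab y by simp
    show "D f (\<pi> y) \<in> carrier F" using D fc y by simp
  qed
  from frac[OF g] obtain c d where cd: "c \<in> carrier A" "d \<in> carrier B" "d \<noteq> \<zero>\<^bsub>B\<^esub>"
    "g \<otimes>\<^bsub>F\<^esub> \<pi> (\<phi> d) = \<pi> c" by blast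
  \<comment> \<open>The same in the second argument, expanding \<open>D f (\<pi> c)\<close> along
    the equation for \<open>g\<close>.\<close>
  show ?thesis
  proof (rule cancel[OF _ _ _ cd(2,3)])
    show "g \<otimes>\<^bsub>F\<^esub> D f (\<pi> (\<phi> d)) \<oplus>\<^bsub>F\<^esub> D f g \<otimes>\<^bsub>F\<^esub> \<pi> (\<phi> d) \<in> extension P"
      using num[OF cd(1)] right[of g "\<pi> (\<phi> d)" f] fc cd g by simp
    show "g \<otimes>\<^bsub>F\<^esub> D f (\<pi> (\<phi> d)) \<in> extension P"
      using Q.I_l_closed[OF num[of "\<phi> d"] g] cd by simp
    show "D f g \<in> carrier F" using D fc g by simp
  qed
qed

lemma bidifferential_prime_extension: "bidifferential_prime F (extension P)"
proof -
  interpret Q: primeideal "extension P" F by (rule primeideal_extension)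
  have base: "bracket F (\<pi> p) (\<pi> a) \<in> extension P \<and> bracket F (\<pi> a) (\<pi> p) \<in> extension P"
    if "p \<in> P" "a \<in> carrier A" for p a
  proof -
    have "bracket A p a \<in> P" "bracket A a p \<in> P" "p \<in> carrier A"
      using P that P.Icarr by (auto simp: bidifferential_prime_def bidifferential_ideal_def)
    moreover have "bracket F (\<pi> p) (\<pi> a) = \<pi> (bracket A p a)" "bracket F (\<pi> a) (\<pi> p) = \<pi> (bracket A a p)"
      using \<pi>(1) that P.Icarr by (auto simp: bidifferential_hom_def)
    ultimately show ?thesis using mem_extension_\<pi> P.Icarr by simp
  qed
  have "bracket F f g \<in> extension P" if "f \<in> extension P" "g \<in> carrier F" for f g
    by (rule bracket_extension) (use that base in \<open>auto simp: F.bracket_mult_left F.bracket_mult_right\<close>)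
  moreover have "bracket F g f \<in> extension P" if "f \<in> extension P" "g \<in> carrier F" for f g
    by (rule bracket_extension[where D = "\<lambda>x y. bracket F y x"])
      (use that base in \<open>auto simp: F.bracket_mult_left F.bracket_mult_right\<close>)
  ultimately show ?thesis
    by (simp add: bidifferential_prime_def bidifferential_ideal_def Q.is_ideal primeideal_extension)
qed

end

section \<open>Comparison of the two intersections of nonzero bidifferential primes\<close>

lemma bidifferential_core_localization:
  assumes c: "c \<in> bidifferential_core B" "c \<noteq> \<zero>\<^bsub>B\<^esub>"
  shows "(\<exists>a\<in>bidifferential_core A. a \<noteq> \<zero>\<^bsub>A\<^esub>) \<longleftrightarrow> (\<exists>f\<in>bidifferential_core F. f \<noteq> \<zero>\<^bsub>F\<^esub>)"
proof
  assume "\<exists>a\<in>bidifferential_core A. a \<noteq> \<zero>\<^bsub>A\<^esub>"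
  then obtain a where a: "a \<in> carrier A" "a \<noteq> \<zero>\<^bsub>A\<^esub>"
    and core: "\<And>P. bidifferential_prime A P \<Longrightarrow> P \<noteq> {\<zero>\<^bsub>A\<^esub>} \<Longrightarrow> a \<in> P"
    by (auto simp: bidifferential_core_def)
  have "\<pi> a \<in> P" if P: "bidifferential_prime F P" "P \<noteq> {\<zero>\<^bsub>F\<^esub>}" for P
  proof -
    interpret P: primeideal P F using P by (simp add: bidifferential_prime_def)
    \<comment> \<open>\<open>core\<close> speaks of nonzero primes only. The numerator of a nonzero
      element of \<open>P\<close> shows that the contraction is nonzero.\<close>
    obtain f where f: "f \<in> P" "f \<noteq> \<zero>\<^bsub>F\<^esub>" using P(2) P.zero_closed by blast
    from frac[OF P.Icarr[OF f(1)]] obtain x b where x: "x \<in> carrier A" "b \<in> carrier B" "b \<noteq> \<zero>\<^bsub>B\<^esub>"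
      "f \<otimes>\<^bsub>F\<^esub> \<pi> (\<phi> b) = \<pi> x" by blast
    have "\<pi> x \<in> P" using P.I_r_closed[OF f(1), of "\<pi> (\<phi> b)"] x by simp
    moreover have "\<pi> x \<noteq> \<zero>\<^bsub>F\<^esub>"
    proof -
      have "\<pi> (\<phi> b) \<noteq> \<zero>\<^bsub>F\<^esub>"
        using \<phi>_nonzero[of b] \<pi>_eq_iff[of "\<phi> b" "\<zero>\<^bsub>A\<^esub>"] x by simp
      then show ?thesis
        using f x P.Icarr F.integral_iff[of f "\<pi> (\<phi> b)"] by auto
    qed
    moreover from this have "x \<noteq> \<zero>\<^bsub>A\<^esub>" by auto
    ultimately have "{y \<in> carrier A. \<pi> y \<in> P} \<noteq> {\<zero>\<^bsub>A\<^esub>}" using x(1) by blast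
    from core[OF bidifferential_prime_vimage[OF A(1) \<pi>(1) P(1)] this] show ?thesis by simp
  qed
  moreover have "\<pi> a \<noteq> \<zero>\<^bsub>F\<^esub>" using \<pi>_eq_iff[of a "\<zero>\<^bsub>A\<^esub>"] a by simp
  ultimately show "\<exists>f\<in>bidifferential_core F. f \<noteq> \<zero>\<^bsub>F\<^esub>"
    using a by (intro bexI[of _ "\<pi> a"]) (auto simp: bidifferential_core_def)
next
  assume "\<exists>f\<in>bidifferential_core F. f \<noteq> \<zero>\<^bsub>F\<^esub>"
  then obtain f where f: "f \<in> carrier F" "f \<noteq> \<zero>\<^bsub>F\<^esub>"
    and core: "\<And>P. bidifferential_prime F P \<Longrightarrow> P \<noteq> {\<zero>\<^bsub>F\<^esub>} \<Longrightarrow> f \<in> P"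
    by (auto simp: bidifferential_core_def)
  from frac[OF f(1)] obtain a b where ab: "a \<in> carrier A" "b \<in> carrier B" "b \<noteq> \<zero>\<^bsub>B\<^esub>"
    "f \<otimes>\<^bsub>F\<^esub> \<pi> (\<phi> b) = \<pi> a" by blast
  have cB: "c \<in> carrier B" using c by (simp add: bidifferential_core_def)
  have "a \<otimes>\<^bsub>A\<^esub> \<phi> c \<in> P" if P: "bidifferential_prime A P" "P \<noteq> {\<zero>\<^bsub>A\<^esub>}" for P
  proof -
    interpret P: primeideal P A using P by (simp add: bidifferential_prime_def)
    show ?thesis
    proof (cases "\<exists>b\<in>carrier B. \<phi> b \<in> P \<and> b \<noteq> \<zero>\<^bsub>B\<^esub>")
      case True
      then have "{b \<in> carrier B. \<phi> b \<in> P} \<noteq> {\<zero>\<^bsub>B\<^esub>}" by auto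
      then have "\<phi> c \<in> P"
        using c bidifferential_prime_vimage[OF B(1) \<phi> P(1)] by (auto simp: bidifferential_core_def)
      then show ?thesis using P.I_l_closed ab by simp
    next
      case False
      then have disjoint: "\<And>b. b \<in> carrier B \<Longrightarrow> \<phi> b \<in> P \<Longrightarrow> b = \<zero>\<^bsub>B\<^esub>" by blast
      obtain p where p: "p \<in> P" "p \<noteq> \<zero>\<^bsub>A\<^esub>" using P(2) P.zero_closed by blast
      then have "\<pi> p \<in> extension P" "\<pi> p \<noteq> \<zero>\<^bsub>F\<^esub>"
        using mem_extension_\<pi>[OF P(1) disjoint] P.Icarr \<pi>_eq_iff[of p "\<zero>\<^bsub>A\<^esub>"] by auto
      then have "f \<in> extension P"
        using core[OF bidifferential_prime_extension[OF P(1) disjoint]] by auto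
      then have "a \<in> P" using ab by (auto simp: extension_def)
      then show ?thesis using P.I_r_closed cB by simp
    qed
  qed
  moreover have "a \<noteq> \<zero>\<^bsub>A\<^esub>"
    using ab f F.integral_iff[of f "\<pi> (\<phi> b)"] \<phi>_nonzero[of b] \<pi>_eq_iff[of "\<phi> b" "\<zero>\<^bsub>A\<^esub>"] by auto
  ultimately show "\<exists>a\<in>bidifferential_core A. a \<noteq> \<zero>\<^bsub>A\<^esub>"
    using ab(1) cB c(2) \<phi>_nonzero[of c]
    by (intro bexI[of _ "a \<otimes>\<^bsub>A\<^esub> \<phi> c"]) (auto simp: bidifferential_core_def A.integral_iff)
qed

end

section \<open>Subvarieties as quotient rings\<close>

text \<open>\<open>subvariety\<close> is a record of its own with extra fields, so facts about the
  quotient ring do not apply to it literally. The identity map is an isomorphism and carries them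
  over.\<close>

lemma domain_cong:
  assumes "domain R"
    and "carrier S = carrier R" "monoid.mult S = monoid.mult R" "\<one>\<^bsub>S\<^esub> = \<one>\<^bsub>R\<^esub>"
      "\<zero>\<^bsub>S\<^esub> = \<zero>\<^bsub>R\<^esub>" "ring.add S = ring.add R"
  shows "domain S"
proof -
  have "id \<in> ring_hom R S"
    by (rule ring_hom_memI) (simp_all only: assms(2-) id_apply)
  then have "id \<in> ring_iso R S"
    by (simp add: ring_iso_def assms(2))
  from domain.ring_iso_imp_img_domain[OF assms(1) this] show ?thesis
    by (simp flip: assms(4,5))
qed

lemma cring_cong:
  assumes "cring R"
    and "carrier S = carrier R" "monoid.mult S = monoid.mult R" "\<one>\<^bsub>S\<^esub> = \<one>\<^bsub>R\<^esub>"
      "\<zero>\<^bsub>S\<^esub> = \<zero>\<^bsub>R\<^esub>" "ring.add S = ring.add R"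
  shows "cring S"
proof -
  have "id \<in> ring_hom R S"
    by (rule ring_hom_memI) (simp_all only: assms(2-) id_apply)
  then have "id \<in> ring_iso R S"
    by (simp add: ring_iso_def assms(2))
  from cring.ring_iso_imp_img_cring[OF assms(1) this] show ?thesis
    by (simp flip: assms(4,5))
qed

lemma bidifferential_ring_image:
  assumes "bidifferential_ring R" "cring S" and h: "h \<in> ring_hom R S"
    and surj: "carrier S = h ` carrier R"
    and bracket: "\<And>a b. a \<in> carrier R \<Longrightarrow> b \<in> carrier R \<Longrightarrow> bracket S (h a) (h b) = h (bracket R a b)"
  shows "bidifferential_ring S"
proof -
  interpret R: bidifferential_cring R using assms(1) by (rule bidifferential_cringI)
  interpret S: cring S by fact
  interpret h: ring_hom_ring R S h by (intro ring_hom_ringI2 R.ring_axioms S.ring_axioms h)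
  have "derivation S (\<lambda>s. bracket S (h a) s) \<and> derivation S (\<lambda>s. bracket S s (h a))"
    if a: "a \<in> carrier R" for a
    unfolding derivation_def surj Set.ball_simps(9)
  proof (intro conjI ballI)
    show "(\<lambda>y. bracket S (h a) y) \<in> h ` carrier R \<rightarrow> h ` carrier R"
      "(\<lambda>y. bracket S y (h a)) \<in> h ` carrier R \<rightarrow> h ` carrier R"
      using a by (auto simp: bracket)
  next
    fix b c assume c: "b \<in> carrier R" "c \<in> carrier R"
    note * = a c R.bracket_closed bracket R.a_closed R.m_closed
    show "bracket S (h a) (h b \<oplus>\<^bsub>S\<^esub> h c) = bracket S (h a) (h b) \<oplus>\<^bsub>S\<^esub> bracket S (h a) (h c)"
      by (simp only: * R.bracket_add_right flip: h.hom_add)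
    show "bracket S (h b \<oplus>\<^bsub>S\<^esub> h c) (h a) = bracket S (h b) (h a) \<oplus>\<^bsub>S\<^esub> bracket S (h c) (h a)"
      by (simp only: * R.bracket_add_left flip: h.hom_add)
    show "bracket S (h a) (h b \<otimes>\<^bsub>S\<^esub> h c) =
        h b \<otimes>\<^bsub>S\<^esub> bracket S (h a) (h c) \<oplus>\<^bsub>S\<^esub> bracket S (h a) (h b) \<otimes>\<^bsub>S\<^esub> h c"
      by (simp only: * R.bracket_mult_right flip: h.hom_add h.hom_mult)
    show "bracket S (h b \<otimes>\<^bsub>S\<^esub> h c) (h a) =
        h b \<otimes>\<^bsub>S\<^esub> bracket S (h c) (h a) \<oplus>\<^bsub>S\<^esub> bracket S (h b) (h a) \<otimes>\<^bsub>S\<^esub> h c"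
      by (simp only: * R.bracket_mult_left flip: h.hom_add h.hom_mult)
  qed
  then show ?thesis
    using assms(2) unfolding bidifferential_ring_def surj by blast
qed

text \<open>Expanding the bracket of i + u and j + v with i and j in \<open>I\<close>, every term
  except the bracket of \<open>u\<close> and \<open>v\<close> has an argument in \<open>I\<close>.
  So the union used as bracket in \<open>subvariety\<close> is a single coset.\<close>

lemma (in bidifferential_cring) bracket_cosets:
  assumes I: "bidifferential_ideal R I" and uv: "u \<in> carrier R" "v \<in> carrier R"
  shows "(\<Union>x\<in>I +> u. \<Union>y\<in>I +> v. I +> bracket R x y) = I +> bracket R u v"
proof -
  interpret I: ideal I R using I by (simp add: bidifferential_ideal_def)
  have coset: "I +> bracket R x y = I +> bracket R u v" if xy: "x \<in> I +> u" "y \<in> I +> v" for x y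
  proof -
    obtain i j where ij: "i \<in> I" "x = i \<oplus> u" "j \<in> I" "y = j \<oplus> v"
      using xy by (auto simp: a_r_coset_def')
    have c: "i \<in> carrier R" "j \<in> carrier R" using ij I.Icarr by auto
    have B: "bracket R i j \<in> I" "bracket R i v \<in> I" "bracket R u j \<in> I"
      using I ij(1,3) c uv by (auto simp: bidifferential_ideal_def)
    have "bracket R x y = (bracket R i j \<oplus> bracket R i v \<oplus> bracket R u j) \<oplus> bracket R u v"
      using c uv by (simp add: ij(2,4) bracket_add_left bracket_add_right a_ac)
    then have "bracket R x y \<in> I +> bracket R u v"
      using B by (auto simp: a_r_coset_def' I.a_closed)
    then show ?thesis using a_repr_independence[of "bracket R x y" I "bracket R u v"] I.a_subgroup uv by simp
  qed
  have self: "u \<in> I +> u" "v \<in> I +> v" using uv I.a_rcos_self by simp_all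
  show ?thesis
  proof (rule equalityI)
    show "(\<Union>x\<in>I +> u. \<Union>y\<in>I +> v. I +> bracket R x y) \<subseteq> I +> bracket R u v"
      by (intro UN_least) (simp only: coset subset_refl)
    show "I +> bracket R u v \<subseteq> (\<Union>x\<in>I +> u. \<Union>y\<in>I +> v. I +> bracket R x y)"
      by (rule subset_trans[OF UN_upper[OF self(2)] UN_upper[OF self(1)]])
  qed
qed

context
  fixes V :: "('k, 'a, 'm) bvariety_scheme" and Z
  assumes V: "bidifferential_ring V" and Z: "bidifferential_ideal V (vanishing_ideal V Z)"
begin

interpretation bidifferential_cring V using V by (rule bidifferential_cringI)
interpretation I: ideal "vanishing_ideal V Z" V using Z by (simp add: bidifferential_ideal_def)

lemma cring_subvariety: "cring (subvariety V Z)"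
  by (rule cring_cong[OF I.quotient_is_cring[OF is_cring]]) (simp_all add: subvariety_def Let_def)

lemma domain_subvariety: "primeideal (vanishing_ideal V Z) V \<Longrightarrow> domain (subvariety V Z)"
  by (rule domain_cong[OF primeideal.quotient_is_domain]) (simp_all add: subvariety_def Let_def)

lemma coset_surj_subvariety: "carrier (subvariety V Z) = (\<lambda>x. vanishing_ideal V Z +>\<^bsub>V\<^esub> x) ` carrier V"
  by (auto simp: subvariety_def Let_def FactRing_def A_RCOSETS_def')

lemma coset_ring_hom_subvariety: "(\<lambda>x. vanishing_ideal V Z +>\<^bsub>V\<^esub> x) \<in> ring_hom V (subvariety V Z)"
  using I.rcos_ring_hom by (simp add: ring_hom_def subvariety_def Let_def)

lemma coset_hom_subvariety:
  "(\<lambda>x. vanishing_ideal V Z +>\<^bsub>V\<^esub> x) \<in> bidifferential_hom V (subvariety V Z)"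
  using coset_ring_hom_subvariety bracket_cosets[OF Z]
  by (simp add: bidifferential_hom_def subvariety_def Let_def)

lemma bidifferential_ring_subvariety: "bidifferential_ring (subvariety V Z)"
  using coset_hom_subvariety
  by (intro bidifferential_ring_image[OF V cring_subvariety coset_ring_hom_subvariety coset_surj_subvariety])
    (simp add: bidifferential_hom_def)

lemma coset_eq_subvariety_iff:
  assumes "x \<in> carrier V" "y \<in> carrier V"
  shows "vanishing_ideal V Z +>\<^bsub>V\<^esub> x = vanishing_ideal V Z +>\<^bsub>V\<^esub> y \<longleftrightarrow> x \<ominus>\<^bsub>V\<^esub> y \<in> vanishing_ideal V Z"
  using quotient_eq_iff_same_a_r_cos[OF I.is_ideal assms] by auto

end

section \<open>The generic fibre\<close>

lemma mem_a_kernel_iff: "x \<in> a_kernel R S h \<longleftrightarrow> x \<in> carrier R \<and> h x = \<zero>\<^bsub>S\<^esub>"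
  unfolding a_kernel_def' by (rule mem_Collect_eq)

lemma primeideal_kernel:
  assumes "cring R" "domain S" and h: "h \<in> ring_hom R S"
  shows "primeideal (a_kernel R S h) R"
proof -
  interpret R: cring R by fact
  interpret S: domain S by fact
  interpret h: ring_hom_ring R S h by (rule ring_hom_ringI2[OF R.ring_axioms S.ring_axioms h])
  have "\<one>\<^bsub>R\<^esub> \<notin> a_kernel R S h"
    unfolding mem_a_kernel_iff h.hom_one using S.one_not_zero by blast
  then have proper: "carrier R \<noteq> a_kernel R S h" using R.one_closed by blast
  have prime: "x \<in> a_kernel R S h \<or> y \<in> a_kernel R S h"
    if "x \<in> carrier R" "y \<in> carrier R" "x \<otimes>\<^bsub>R\<^esub> y \<in> a_kernel R S h" for x y
    using that S.integral unfolding mem_a_kernel_iff by auto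
  show ?thesis
    by (rule primeidealI[OF h.kernel_is_ideal R.is_cring proper prime])
qed

text \<open>Every point in the image contains the kernel. The closed set defined by the kernel is
  therefore the whole spectrum by density, and so contains the zero ideal.\<close>

lemma dominant_imp_inj:
  assumes "domain V" "domain W" and \<phi>: "\<phi> \<in> ring_hom W V" and "dominant V W \<phi>"
    and a: "a \<in> carrier W" "\<phi> a = \<zero>\<^bsub>V\<^esub>"
  shows "a = \<zero>\<^bsub>W\<^esub>"
proof -
  interpret V: domain V by fact
  interpret W: domain W by fact
  interpret \<phi>: ring_hom_ring W V \<phi> by (rule ring_hom_ringI2[OF W.ring_axioms V.ring_axioms \<phi>])
  let ?Z = "{P \<in> Spec W. a_kernel W V \<phi> \<subseteq> P}"
  have prime: "primeideal (point_map W \<phi> P) W" if P: "primeideal P V" for P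
  proof -
    interpret P: primeideal P V by fact
    show ?thesis
    proof (rule primeidealI)
      show "ideal (point_map W \<phi> P) W"
        unfolding point_map_def
        by (rule idealI[OF W.ring_axioms W.add.subgroupI])
          (auto simp: P.a_closed P.a_inv_closed P.zero_closed P.I_l_closed P.I_r_closed)
      have "\<one>\<^bsub>W\<^esub> \<notin> point_map W \<phi> P"
        using P.I_notcarr P.one_imp_carrier by (auto simp: point_map_def)
      then show "carrier W \<noteq> point_map W \<phi> P" using W.one_closed by blast
    qed (use P.I_prime in \<open>auto simp: point_map_def W.is_cring\<close>)
  qed
  have "a_kernel W V \<phi> \<subseteq> point_map W \<phi> P" if "primeideal P V" for P
  proof -
    have "\<zero>\<^bsub>V\<^esub> \<in> P"
      using that by (simp add: additive_subgroup.zero_closed ideal_def primeideal_def)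
    then show ?thesis unfolding point_map_def by (auto simp only: mem_a_kernel_iff)
  qed
  then have "point_map W \<phi> ` Spec V \<subseteq> ?Z" using prime by (auto simp: Spec_def)
  moreover have "zariski_closed W ?Z"
    unfolding zariski_closed_def using \<phi>.kernel_is_ideal by blast
  ultimately have Z: "?Z = Spec W" using \<open>dominant V W \<phi>\<close> unfolding dominant_def by blast
  have "{\<zero>\<^bsub>W\<^esub>} \<in> Spec W" unfolding Spec_def using W.zeroprimeideal by (rule CollectI)
  then have "{\<zero>\<^bsub>W\<^esub>} \<in> ?Z" by (subst Z)
  then have "a_kernel W V \<phi> \<subseteq> {\<zero>\<^bsub>W\<^esub>}" unfolding mem_Collect_eq by (rule conjunct2)
  then show ?thesis using a mem_a_kernel_iff[of a W V \<phi>] by blast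
qed

text \<open>Genericity is tested on the closed set defined by \<open>Q\<close> itself, to which the
  zero ideal must then belong.\<close>

lemma zariski_generic_imp_zero:
  assumes "domain W" "primeideal Q W" "zariski_generic W Q"
  shows "Q = {\<zero>\<^bsub>W\<^esub>}"
proof -
  interpret W: domain W by fact
  interpret Q: primeideal Q W by fact
  have Z: "{P \<in> Spec W. Q \<subseteq> P} = Spec W"
    using assms(2,3) Q.is_ideal unfolding zariski_generic_def zariski_closed_def Spec_def by blast
  have "{\<zero>\<^bsub>W\<^esub>} \<in> Spec W" unfolding Spec_def using W.zeroprimeideal by (rule CollectI)
  then have "{\<zero>\<^bsub>W\<^esub>} \<in> {P \<in> Spec W. Q \<subseteq> P}" by (subst Z)
  then have "Q \<subseteq> {\<zero>\<^bsub>W\<^esub>}" unfolding mem_Collect_eq by (rule conjunct2)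
  then show ?thesis using Q.zero_closed by blast
qed

lemma bidifferential_hom_imp_ring_hom: "f \<in> bidifferential_hom R S \<Longrightarrow> f \<in> ring_hom R S"
  by (simp add: bidifferential_hom_def)

locale generic_fibre =
  fixes k :: "('k, 'm1) biring_scheme" and V :: "('k, 'a, 'm2) bvariety_scheme"
    and W :: "('k, 'b, 'm3) bvariety_scheme" and \<phi> :: "'b \<Rightarrow> 'a"
    and L :: "('l, 'm4) biring_scheme" and h :: "'k \<Rightarrow> 'l"
    and VL :: "('l, 's, 'm5) bvariety_scheme" and iV :: "'a \<Rightarrow> 's"
    and WL :: "('l, 't, 'm6) bvariety_scheme" and iW :: "'b \<Rightarrow> 't"
    and \<phi>L :: "'t \<Rightarrow> 's" and \<alpha> :: "'t \<Rightarrow> 'l"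
  assumes irreducible_V: "irreducible_B_variety k V" and irreducible_W: "irreducible_B_variety k W"
    and morphism: "B_morphism k V W \<phi>" and dominant: "dominant V W \<phi>"
    and generic: "generic_B_fibre k V W \<phi> L h VL iV WL iW \<phi>L \<alpha>"
    and point_field: "field_of_point k W L h iW \<alpha> = carrier L"
begin

text \<open>Evaluation of functions on W at the generic point. This is the embedding through which
  \<open>L\<close> is treated as the fraction field of k[W].\<close>

definition \<beta> :: "'b \<Rightarrow> 'l" where "\<beta> y = \<alpha> (iW y)"

abbreviation "Z \<equiv> fibre VL WL \<phi>L (a_kernel WL L \<alpha>)"
abbreviation "F \<equiv> subvariety VL Z"
abbreviation "I \<equiv> vanishing_ideal VL Z"
abbreviation "q \<equiv> \<lambda>x. I +>\<^bsub>VL\<^esub> x"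
abbreviation "s \<equiv> scalar VL"

lemma bidifferential_V: "bidifferential_ring V" and bidifferential_W: "bidifferential_ring W"
  and bidifferential_VL: "bidifferential_ring VL" and bidifferential_WL: "bidifferential_ring WL"
  and field_L: "field L" and bidifferential_L: "bidifferential_field L"
  and field_k: "field k"
  using irreducible_V irreducible_W generic
  by (simp_all add: irreducible_B_variety_def B_variety_def generic_B_fibre_def
      compatible_base_extension_def bidifferential_field_def)

lemma domain_V: "domain V" and domain_W: "domain W"
  using irreducible_V irreducible_W bidifferential_V bidifferential_W
  by (auto simp: irreducible_B_variety_def B_variety_def bidifferential_ring_def
      intro!: domain_if_reduced_irreducible)

lemma tensor_V: "is_tensor_product k V (scalar V) L h VL iV s"
  and tensor_W: "is_tensor_product k W (scalar W) L h WL iW (scalar WL)"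
  using generic by (simp_all add: generic_B_fibre_def compatible_base_extension_def)

lemma homs: "\<phi> \<in> bidifferential_hom W V" "h \<in> bidifferential_hom k L"
    "iV \<in> bidifferential_hom V VL" "iW \<in> bidifferential_hom W WL"
    "s \<in> bidifferential_hom L VL" "scalar WL \<in> bidifferential_hom L WL"
    "\<phi>L \<in> bidifferential_hom WL VL" "scalar V \<in> bidifferential_hom k V"
    "scalar W \<in> bidifferential_hom k W"
  using irreducible_V irreducible_W morphism generic
  by (simp_all add: irreducible_B_variety_def B_variety_def generic_B_fibre_def B_morphism_def
      compatible_base_extension_def)

lemmas ring_homs = homs[THEN bidifferential_hom_imp_ring_hom]

lemma \<alpha>_hom: "\<alpha> \<in> ring_hom WL L" and \<alpha>_scalar: "c \<in> carrier L \<Longrightarrow> \<alpha> (scalar WL c) = c"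
  using generic by (simp_all add: generic_B_fibre_def B_point_def rational_point_def)

lemma \<phi>L_scalar: "x \<in> carrier L \<Longrightarrow> \<phi>L (scalar WL x) = s x"
  and \<phi>L_iW: "y \<in> carrier W \<Longrightarrow> \<phi>L (iW y) = iV (\<phi> y)"
  and \<phi>_scalar: "c \<in> carrier k \<Longrightarrow> \<phi> (scalar W c) = scalar V c"
  using generic morphism by (simp_all add: generic_B_fibre_def B_morphism_def)

sublocale L: field L by (rule field_L)
sublocale k: field k by (rule field_k)
sublocale V: domain V by (rule domain_V)
sublocale W: domain W by (rule domain_W)
sublocale VL: bidifferential_cring VL by (rule bidifferential_cringI[OF bidifferential_VL])
sublocale WL: bidifferential_cring WL by (rule bidifferential_cringI[OF bidifferential_WL])
sublocale \<phi>: ring_hom_ring W V \<phi> by (rule ring_hom_ringI2[OF W.ring_axioms V.ring_axioms ring_homs(1)])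
sublocale h: ring_hom_ring k L h by (rule ring_hom_ringI2[OF k.ring_axioms L.ring_axioms ring_homs(2)])
sublocale iV: ring_hom_ring V VL iV by (rule ring_hom_ringI2[OF V.ring_axioms VL.ring_axioms ring_homs(3)])
sublocale iW: ring_hom_ring W WL iW by (rule ring_hom_ringI2[OF W.ring_axioms WL.ring_axioms ring_homs(4)])
sublocale s: ring_hom_ring L VL s by (rule ring_hom_ringI2[OF L.ring_axioms VL.ring_axioms ring_homs(5)])
sublocale sW: ring_hom_ring L WL "scalar WL" by (rule ring_hom_ringI2[OF L.ring_axioms WL.ring_axioms ring_homs(6)])
sublocale \<phi>L: ring_hom_ring WL VL \<phi>L by (rule ring_hom_ringI2[OF WL.ring_axioms VL.ring_axioms ring_homs(7)])
sublocale scV: ring_hom_ring k V "scalar V" by (rule ring_hom_ringI2[OF k.ring_axioms V.ring_axioms ring_homs(8)])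
sublocale scW: ring_hom_ring k W "scalar W" by (rule ring_hom_ringI2[OF k.ring_axioms W.ring_axioms ring_homs(9)])
sublocale \<alpha>: ring_hom_ring WL L \<alpha> by (rule ring_hom_ringI2[OF WL.ring_axioms L.ring_axioms \<alpha>_hom])

section \<open>\<open>L\<close> as the fraction field of k[W] through the point \<alpha>\<close>

lemma \<phi>_inj: "b \<in> carrier W \<Longrightarrow> \<phi> b = \<zero>\<^bsub>V\<^esub> \<Longrightarrow> b = \<zero>\<^bsub>W\<^esub>"
  by (rule dominant_imp_inj[OF domain_V domain_W ring_homs(1) dominant])

lemma \<beta>_ring_hom: "\<beta> \<in> ring_hom W L"
  by (rule ring_hom_memI) (simp_all add: \<beta>_def)

sublocale \<beta>: ring_hom_ring W L \<beta> by (rule ring_hom_ringI2[OF W.ring_axioms L.ring_axioms \<beta>_ring_hom])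

text \<open>The kernel of \<beta> is the image of \<alpha> under the projection to W, a prime at
  which genericity is assumed.\<close>

lemma \<beta>_zero: assumes "b \<in> carrier W" "\<beta> b = \<zero>\<^bsub>L\<^esub>" shows "b = \<zero>\<^bsub>W\<^esub>"
proof -
  have eq: "point_map W iW (a_kernel WL L \<alpha>) = a_kernel W L \<beta>"
    unfolding point_map_def a_kernel_def' \<beta>_def by auto
  have "a_kernel W L \<beta> = {\<zero>\<^bsub>W\<^esub>}"
  proof (rule zariski_generic_imp_zero[OF domain_W])
    show "primeideal (a_kernel W L \<beta>) W"
      by (rule primeideal_kernel[OF W.is_cring L.domain_axioms \<beta>_ring_hom])
    show "zariski_generic W (a_kernel W L \<beta>)"
      using generic by (simp add: generic_B_fibre_def eq)
  qed
  then show ?thesis using assms mem_a_kernel_iff[of b W L \<beta>] by blast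
qed

lemma \<beta>_inj: "inj_on \<beta> (carrier W)"
proof (rule inj_onI)
  fix x y assume xy: "x \<in> carrier W" "y \<in> carrier W" "\<beta> x = \<beta> y"
  then have "\<beta> (x \<ominus>\<^bsub>W\<^esub> y) = \<zero>\<^bsub>L\<^esub>" by (simp add: a_minus_def L.r_neg)
  then show "x = y" using \<beta>_zero[of "x \<ominus>\<^bsub>W\<^esub> y"] xy by simp
qed

lemma \<beta>_scalar:
  assumes "c \<in> carrier k"
  shows "\<beta> (scalar W c) = h c"
proof -
  have "iW (scalar W c) = scalar WL (h c)"
    by (rule tensor_product_balanced[OF tensor_W W.ring_axioms L.ring_axioms assms])
      (use assms in simp_all)
  then show ?thesis using \<alpha>_scalar[of "h c"] assms by (simp add: \<beta>_def)
qed

text \<open>By \<open>\<beta>_scalar\<close> the constants from \<open>k\<close> already lie in the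
  image of \<beta>, so k(\<alpha>) is generated as a field by that image alone.\<close>

lemma L_fractions:
  assumes "x \<in> carrier L"
  shows "\<exists>a\<in>carrier W. \<exists>b\<in>carrier W. b \<noteq> \<zero>\<^bsub>W\<^esub> \<and> x \<otimes>\<^bsub>L\<^esub> \<beta> b = \<beta> a"
proof -
  have "h ` carrier k \<union> (\<lambda>y. \<alpha> (iW y)) ` carrier W = \<beta> ` carrier W"
  proof -
    have "h ` carrier k \<subseteq> \<beta> ` carrier W"
      using \<beta>_scalar by (metis image_eqI image_subsetI scW.hom_closed)
    then show ?thesis unfolding \<beta>_def[abs_def] by blast
  qed
  then have "x \<in> generate_field L (\<beta> ` carrier W)"
    using assms point_field by (simp add: field_of_point_def)
  from L.generate_field_fractions[OF domain_W \<beta>_ring_hom \<beta>_inj this] show ?thesis by blast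
qed

lemma \<beta>_nonzero: "b \<in> carrier W \<Longrightarrow> b \<noteq> \<zero>\<^bsub>W\<^esub> \<Longrightarrow> \<beta> b \<in> Units L"
  using \<beta>_zero[of b] by (auto simp: L.field_Units)

text \<open>The generic point of V, seen as a point of the fibre. The inclusion of k[V] in its
  fraction field and the map \<psi> from \<open>L\<close> induced by \<phi> agree on
  \<open>k\<close>, so they combine to a homomorphism \<open>u\<close> on \<open>VL\<close>; the
  prime is its kernel. Injectivity of \<phi> is what lets \<psi> exist.\<close>

lemma exists_generic_prime:
  obtains Q where "primeideal Q VL" "Q \<in> Z" "\<And>a. a \<in> carrier V \<Longrightarrow> iV a \<in> Q \<Longrightarrow> a = \<zero>\<^bsub>V\<^esub>"
proof -
  let ?K = "domain.fraction_ring V" and ?e = "\<lambda>a. domain.frac V a \<one>\<^bsub>V\<^esub>"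
  interpret K: field ?K by (rule V.field_fraction_ring)
  interpret e: ring_hom_ring V ?K ?e
    by (rule ring_hom_ringI2[OF V.ring_axioms K.ring_axioms V.frac_ring_hom])
  have e_zero: "a = \<zero>\<^bsub>V\<^esub>" if "a \<in> carrier V" "?e a = \<zero>\<^bsub>?K\<^esub>" for a
    using inj_onD[OF V.frac_inj, of a "\<zero>\<^bsub>V\<^esub>"] that e.hom_zero by simp
  have e\<phi>: "?e \<circ> \<phi> \<in> ring_hom W ?K"
    using ring_hom_trans[OF ring_homs(1) V.frac_ring_hom] .
  have e\<phi>_unit: "(?e \<circ> \<phi>) b \<in> Units ?K" if "b \<in> carrier W" "b \<noteq> \<zero>\<^bsub>W\<^esub>" for b
    using that e_zero[of "\<phi> b"] \<phi>_inj[of b] e.hom_closed[of "\<phi> b"] by (auto simp: K.field_Units)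
  obtain \<psi> where \<psi>: "\<psi> \<in> ring_hom L ?K" and \<psi>\<beta>: "\<And>b. b \<in> carrier W \<Longrightarrow> \<psi> (\<beta> b) = (?e \<circ> \<phi>) b"
    using fractions_hom_extension[OF domain_W L.is_cring K.is_cring \<beta>_ring_hom \<beta>_inj e\<phi> e\<phi>_unit L_fractions]
    by blast
  interpret \<psi>: ring_hom_ring L ?K \<psi> by (rule ring_hom_ringI2[OF L.ring_axioms K.ring_axioms \<psi>])
  have "?e (scalar V c) = \<psi> (h c)" if "c \<in> carrier k" for c
    using \<psi>\<beta>[of "scalar W c"] \<beta>_scalar[OF that] \<phi>_scalar[OF that] that by simp
  then obtain u where u: "u \<in> ring_hom VL ?K" and u_iV: "\<And>a. a \<in> carrier V \<Longrightarrow> u (iV a) = ?e a"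
    and u_s: "\<And>c. c \<in> carrier L \<Longrightarrow> u (s c) = \<psi> c"
    using tensor_product_universal[OF tensor_V V.ring_axioms L.ring_axioms _ _ K.is_cring V.frac_ring_hom \<psi>]
    by (metis Pi_I h.hom_closed scV.hom_closed)
  interpret u: ring_hom_ring VL ?K u by (rule ring_hom_ringI2[OF VL.ring_axioms K.ring_axioms u])
  \<comment> \<open>On functions from W this is the defining property of \<psi>, and on scalars
    \<alpha> is the identity; pure tensors are products of the two kinds.\<close>
  have u\<phi>L: "u (\<phi>L w) = \<psi> (\<alpha> w)" if "w \<in> carrier WL" for w
    using tensor_W that
  proof (induction rule: tensor_product_induct)
    case (pure b c)
    then show ?case using u_iV[of "\<phi> b"] u_s[of c] \<psi>\<beta>[of b] by (simp add: \<phi>L_iW \<phi>L_scalar \<alpha>_scalar \<beta>_def)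
  next
    case zero
    show ?case by simp
  next
    case (diff w v)
    then show ?case by (simp add: a_minus_def)
  qed
  \<comment> \<open>Injectivity of \<psi> makes the contraction of the kernel of \<open>u\<close>
    along \<open>\<phi>L\<close> equal to the kernel of \<alpha>, and not merely contain it.\<close>
  have \<psi>_zero: "c = \<zero>\<^bsub>L\<^esub>" if c: "c \<in> carrier L" "\<psi> c = \<zero>\<^bsub>?K\<^esub>" for c
  proof (rule ccontr)
    assume "c \<noteq> \<zero>\<^bsub>L\<^esub>"
    then have unit: "c \<in> Units L" using c by (simp add: L.field_Units)
    have "\<psi> (c \<otimes>\<^bsub>L\<^esub> inv\<^bsub>L\<^esub> c) = \<zero>\<^bsub>?K\<^esub> \<otimes>\<^bsub>?K\<^esub> \<psi> (inv\<^bsub>L\<^esub> c)"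
      unfolding c(2)[symmetric] using unit c(1) by (intro \<psi>.hom_mult) simp_all
    then show False using unit by simp
  qed
  let ?Q = "a_kernel VL ?K u"
  have prime: "primeideal ?Q VL" by (rule primeideal_kernel[OF VL.is_cring K.domain_axioms u])
  have "point_map WL \<phi>L ?Q = a_kernel WL L \<alpha>"
    unfolding point_map_def
    using u\<phi>L \<psi>_zero unfolding a_kernel_def' by auto
  then have "?Q \<in> Z" using prime by (simp add: fibre_def Spec_def)
  moreover have "a = \<zero>\<^bsub>V\<^esub>" if "a \<in> carrier V" "iV a \<in> ?Q" for a
    using that e_zero[of a] u_iV[of a] unfolding mem_a_kernel_iff by simp
  ultimately show ?thesis using that prime by blast
qed

section \<open>The coordinate ring of the fibre as a localization of k[V]\<close>

lemma I_ideal: "bidifferential_ideal VL I"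
  using generic by (simp add: generic_B_fibre_def B_subvariety_def)

sublocale F: cring F by (rule cring_subvariety[OF bidifferential_VL I_ideal])
sublocale I: ideal I VL using I_ideal by (simp add: bidifferential_ideal_def)
sublocale q: ring_hom_ring VL F q
  by (rule ring_hom_ringI2[OF VL.ring_axioms F.ring_axioms coset_ring_hom_subvariety[OF bidifferential_VL I_ideal]])

lemmas q_surj = coset_surj_subvariety[OF bidifferential_VL I_ideal]
lemmas q_eq_iff = coset_eq_subvariety_iff[OF bidifferential_VL I_ideal]

lemma q_zero_iff:
  assumes "x \<in> carrier VL"
  shows "q x = \<zero>\<^bsub>F\<^esub> \<longleftrightarrow> x \<in> I"
proof -
  have "q x = q \<zero>\<^bsub>VL\<^esub> \<longleftrightarrow> x \<ominus>\<^bsub>VL\<^esub> \<zero>\<^bsub>VL\<^esub> \<in> I" using assms by (intro q_eq_iff) simp_all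
  moreover have "x \<ominus>\<^bsub>VL\<^esub> \<zero>\<^bsub>VL\<^esub> = x" using assms by (simp add: a_minus_def)
  ultimately show ?thesis unfolding q.hom_zero by simp
qed

text \<open>The difference of \<open>iW b\<close> and the scalar \<beta> b vanishes at \<alpha>, so
  its pullback lies in every prime of the fibre.\<close>

lemma q_iV_\<phi>:
  assumes b: "b \<in> carrier W"
  shows "q (iV (\<phi> b)) = q (s (\<beta> b))"
proof -
  let ?w = "iW b \<ominus>\<^bsub>WL\<^esub> scalar WL (\<beta> b)"
  have "\<alpha> ?w = \<zero>\<^bsub>L\<^esub>"
    using b by (simp add: a_minus_def \<alpha>_scalar L.r_neg flip: \<beta>_def)
  then have "?w \<in> a_kernel WL L \<alpha>" unfolding mem_a_kernel_iff using b by simp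
  then have "\<phi>L ?w \<in> P" if "P \<in> Z" for P
    using that unfolding fibre_def point_map_def by blast
  then have "\<phi>L ?w \<in> I"
    unfolding vanishing_ideal_def using b by simp
  moreover have "\<phi>L ?w = iV (\<phi> b) \<ominus>\<^bsub>VL\<^esub> s (\<beta> b)"
    using b by (simp add: a_minus_def \<phi>L_iW \<phi>L_scalar)
  ultimately show ?thesis using b by (simp add: q_eq_iff)
qed

lemma q_iV_\<phi>_Units: "b \<in> carrier W \<Longrightarrow> b \<noteq> \<zero>\<^bsub>W\<^esub> \<Longrightarrow> q (iV (\<phi> b)) \<in> Units F"
proof -
  assume b: "b \<in> carrier W" "b \<noteq> \<zero>\<^bsub>W\<^esub>"
  note u = \<beta>_nonzero[OF b]
  have "q (s (\<beta> b)) \<otimes>\<^bsub>F\<^esub> q (s (inv\<^bsub>L\<^esub> \<beta> b)) = q (s (\<beta> b \<otimes>\<^bsub>L\<^esub> inv\<^bsub>L\<^esub> \<beta> b))"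
    using u b by (simp only: q.hom_mult s.hom_mult s.hom_closed \<beta>.hom_closed L.Units_inv_closed)
  also have "\<dots> = \<one>\<^bsub>F\<^esub>"
    using u by (simp only: L.Units_r_inv s.hom_one q.hom_one)
  finally have *: "q (s (\<beta> b)) \<otimes>\<^bsub>F\<^esub> q (s (inv\<^bsub>L\<^esub> \<beta> b)) = \<one>\<^bsub>F\<^esub>" .
  have closed: "q (s (\<beta> b)) \<in> carrier F" "q (s (inv\<^bsub>L\<^esub> \<beta> b)) \<in> carrier F"
    using u b by simp_all
  show ?thesis
    unfolding q_iV_\<phi>[OF b(1)] Units_def using closed * F.m_comm[OF closed] by auto
qed

text \<open>For a pure tensor, write the scalar as a fraction from W and trade its numerator for an
  element of k[V] by \<open>q_iV_\<phi>\<close>. Differences go over a common denominator.\<close>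

lemma F_fractions:
  assumes "x \<in> carrier VL"
  shows "\<exists>a\<in>carrier V. \<exists>b\<in>carrier W. b \<noteq> \<zero>\<^bsub>W\<^esub> \<and> q x \<otimes>\<^bsub>F\<^esub> q (iV (\<phi> b)) = q (iV a)"
  using tensor_V assms
proof (induction rule: tensor_product_induct)
  case (pure a c)
  obtain a' b where ab: "a' \<in> carrier W" "b \<in> carrier W" "b \<noteq> \<zero>\<^bsub>W\<^esub>" "c \<otimes>\<^bsub>L\<^esub> \<beta> b = \<beta> a'"
    using L_fractions[OF pure(2)] by blast
  have "q (iV a \<otimes>\<^bsub>VL\<^esub> s c) \<otimes>\<^bsub>F\<^esub> q (iV (\<phi> b)) = q (iV a) \<otimes>\<^bsub>F\<^esub> q (s (c \<otimes>\<^bsub>L\<^esub> \<beta> b))"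
    unfolding q_iV_\<phi>[OF ab(2)] using pure ab(2)
    by (simp only: q.hom_mult s.hom_mult s.hom_closed iV.hom_closed \<beta>.hom_closed F.m_assoc q.hom_closed)
  also have "\<dots> = q (iV (a \<otimes>\<^bsub>V\<^esub> \<phi> a'))"
    unfolding ab(4) q_iV_\<phi>[OF ab(1), symmetric] using pure ab(1)
    by (simp only: q.hom_mult iV.hom_mult iV.hom_closed \<phi>.hom_closed)
  finally show ?case using pure ab by (intro bexI[of _ "a \<otimes>\<^bsub>V\<^esub> \<phi> a'"] bexI[of _ b]) simp_all
next
  case zero
  show ?case by (intro bexI[of _ "\<zero>\<^bsub>V\<^esub>"] bexI[of _ "\<one>\<^bsub>W\<^esub>"]) simp_all
next
  case (diff x y)
  then obtain a b c d where ab: "a \<in> carrier V" "b \<in> carrier W" "b \<noteq> \<zero>\<^bsub>W\<^esub>" "q x \<otimes>\<^bsub>F\<^esub> q (iV (\<phi> b)) = q (iV a)"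
    and cd: "c \<in> carrier V" "d \<in> carrier W" "d \<noteq> \<zero>\<^bsub>W\<^esub>" "q y \<otimes>\<^bsub>F\<^esub> q (iV (\<phi> d)) = q (iV c)" by blast
  have qc: "q x \<in> carrier F" "q y \<in> carrier F" "q (iV (\<phi> b)) \<in> carrier F" "q (iV (\<phi> d)) \<in> carrier F"
    using diff(1,2) ab(2) cd(2) by simp_all
  have "q (x \<ominus>\<^bsub>VL\<^esub> y) \<otimes>\<^bsub>F\<^esub> q (iV (\<phi> (b \<otimes>\<^bsub>W\<^esub> d)))
      = (q x \<ominus>\<^bsub>F\<^esub> q y) \<otimes>\<^bsub>F\<^esub> (q (iV (\<phi> b)) \<otimes>\<^bsub>F\<^esub> q (iV (\<phi> d)))"
    using diff(1,2) ab(2) cd(2) by (simp add: a_minus_def)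
  also have "\<dots> = (q x \<otimes>\<^bsub>F\<^esub> q (iV (\<phi> b))) \<otimes>\<^bsub>F\<^esub> q (iV (\<phi> d))
      \<ominus>\<^bsub>F\<^esub> (q y \<otimes>\<^bsub>F\<^esub> q (iV (\<phi> d))) \<otimes>\<^bsub>F\<^esub> q (iV (\<phi> b))"
    using qc by algebra
  also have "\<dots> = q (iV (a \<otimes>\<^bsub>V\<^esub> \<phi> d \<ominus>\<^bsub>V\<^esub> c \<otimes>\<^bsub>V\<^esub> \<phi> b))"
    unfolding ab(4) cd(4) using ab(1,2) cd(1,2) by (simp add: a_minus_def)
  finally show ?case using ab(1-3) cd(1-3)
    by (intro bexI[of _ "a \<otimes>\<^bsub>V\<^esub> \<phi> d \<ominus>\<^bsub>V\<^esub> c \<otimes>\<^bsub>V\<^esub> \<phi> b"] bexI[of _ "b \<otimes>\<^bsub>W\<^esub> d"])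
      (simp_all add: W.integral_iff)
qed

text \<open>Both facts hold because \<open>I\<close> equals the prime \<open>Q\<close> from
  \<open>exists_generic_prime\<close>. It is contained in \<open>Q\<close> as an intersection of
  primes including \<open>Q\<close>. Conversely, for \<open>x\<close> in \<open>Q\<close> a multiple
  by a unit modulo \<open>I\<close> is congruent to some \<open>iV a\<close>; then
  \<open>iV a\<close> is in \<open>Q\<close>, so \<open>a\<close> is zero, and cancelling the unit
  puts \<open>x\<close> in \<open>I\<close>.\<close>

lemma vanishing_ideal_prime: "primeideal I VL"
  and iV_vanishing: "a \<in> carrier V \<Longrightarrow> iV a \<in> I \<Longrightarrow> a = \<zero>\<^bsub>V\<^esub>"
proof -
  obtain Q where Q: "primeideal Q VL" "Q \<in> Z" and QV: "\<And>a. a \<in> carrier V \<Longrightarrow> iV a \<in> Q \<Longrightarrow> a = \<zero>\<^bsub>V\<^esub>"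
    using exists_generic_prime by blast
  interpret Q: primeideal Q VL by fact
  have IQ: "I \<subseteq> Q" using Q(2) unfolding vanishing_ideal_def by blast
  moreover have "Q \<subseteq> I"
  proof
    fix x assume x: "x \<in> Q"
    then have xc: "x \<in> carrier VL" by (rule Q.Icarr)
    obtain a b where ab: "a \<in> carrier V" "b \<in> carrier W" "b \<noteq> \<zero>\<^bsub>W\<^esub>" "q x \<otimes>\<^bsub>F\<^esub> q (iV (\<phi> b)) = q (iV a)"
      using F_fractions[OF xc] by blast
    let ?y = "x \<otimes>\<^bsub>VL\<^esub> iV (\<phi> b)"
    have "q ?y = q (iV a)" using ab(2,4) xc by simp
    then have "?y \<ominus>\<^bsub>VL\<^esub> iV a \<in> Q" using q_eq_iff[of ?y "iV a"] IQ ab(1,2) xc by auto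
    moreover have y: "?y \<in> Q" using Q.I_r_closed[OF x] ab(2) by simp
    ultimately have "?y \<ominus>\<^bsub>VL\<^esub> (?y \<ominus>\<^bsub>VL\<^esub> iV a) \<in> Q"
      by (simp add: a_minus_def Q.a_closed Q.a_inv_closed del: VL.minus_add)
    moreover have "?y \<ominus>\<^bsub>VL\<^esub> (?y \<ominus>\<^bsub>VL\<^esub> iV a) = iV a"
      using Q.Icarr[OF y] iV.hom_closed[OF ab(1)] by algebra
    ultimately have "a = \<zero>\<^bsub>V\<^esub>" using QV ab(1) by simp
    then have "q x \<otimes>\<^bsub>F\<^esub> q (iV (\<phi> b)) = \<zero>\<^bsub>F\<^esub> \<otimes>\<^bsub>F\<^esub> q (iV (\<phi> b))"
      unfolding ab(4) using ab(2) by simp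
    then have "q x = \<zero>\<^bsub>F\<^esub>"
      using F.Units_r_cancel[OF q_iV_\<phi>_Units[OF ab(2,3)]] xc by simp
    then show "x \<in> I" using q_zero_iff xc by simp
  qed
  ultimately have "I = Q" by blast
  then show "primeideal I VL" "a \<in> carrier V \<Longrightarrow> iV a \<in> I \<Longrightarrow> a = \<zero>\<^bsub>V\<^esub>" using Q(1) QV by simp_all
qed

sublocale localization: bidifferential_localization V W F \<phi> "q \<circ> iV"
proof (rule bidifferential_localization.intro)
  show "bidifferential_ring F" by (rule bidifferential_ring_subvariety[OF bidifferential_VL I_ideal])
  show "domain F" by (rule domain_subvariety[OF bidifferential_VL I_ideal vanishing_ideal_prime])
  show "q \<circ> iV \<in> bidifferential_hom V F"
    using coset_hom_subvariety[OF bidifferential_VL I_ideal] homs(3)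
    by (auto simp: bidifferential_hom_def intro: ring_hom_trans)
  show "inj_on (q \<circ> iV) (carrier V)"
  proof (rule inj_onI)
    fix a b assume ab: "a \<in> carrier V" "b \<in> carrier V" "(q \<circ> iV) a = (q \<circ> iV) b"
    then have "iV (a \<ominus>\<^bsub>V\<^esub> b) \<in> I" by (simp add: q_eq_iff a_minus_def)
    then show "a = b" using iV_vanishing[of "a \<ominus>\<^bsub>V\<^esub> b"] ab by simp
  qed
  show "(q \<circ> iV) (\<phi> b) \<in> Units F" if "b \<in> carrier W" "b \<noteq> \<zero>\<^bsub>W\<^esub>" for b
    using q_iV_\<phi>_Units[OF that] by simp
  show "\<exists>a\<in>carrier V. \<exists>b\<in>carrier W. b \<noteq> \<zero>\<^bsub>W\<^esub> \<and> f \<otimes>\<^bsub>F\<^esub> (q \<circ> iV) (\<phi> b) = (q \<circ> iV) a"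
    if f: "f \<in> carrier F" for f
  proof -
    obtain x where "x \<in> carrier VL" "f = q x" using f q_surj by blast
    then show ?thesis using F_fractions[of x] by simp
  qed
qed (fact bidifferential_V bidifferential_W domain_V domain_W homs(1))+

text \<open>\<open>B_locally_closed\<close> includes being an irreducible variety, so this is owed
  for the fibre. A domain is reduced and irreducible, and generators of k[V] over \<open>k\<close>
  generate the fibre ring over \<open>L\<close>.\<close>

lemma irreducible_fibre: "irreducible_B_variety L F"
proof -
  have scalar: "scalar F = q \<circ> s" by (auto simp: subvariety_def Let_def)
  obtain S where S: "finite S" "S \<subseteq> carrier V" "generate_ring V (scalar V ` carrier k \<union> S) = carrier V"
    using irreducible_V by (auto simp: irreducible_B_variety_def B_variety_def)
  let ?T = "(q \<circ> iV) ` S"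
  let ?G = "generate_ring F (scalar F ` carrier L \<union> ?T)"
  have sub: "scalar F ` carrier L \<union> ?T \<subseteq> carrier F"
    using S(2) by (auto simp: scalar)
  have G: "subring ?G F" by (rule F.generate_ring_is_subring[OF sub])
  have "q (iV a) \<in> ?G" if "a \<in> generate_ring V (scalar V ` carrier k \<union> S)" for a
    using that
  proof (induction rule: generate_ring.induct)
    case one
    show ?case using subringE(3)[OF G] by simp
  next
    case (incl a)
    then show ?case
    proof
      assume "a \<in> scalar V ` carrier k"
      then obtain c where c: "c \<in> carrier k" "a = scalar V c" by blast
      \<comment> \<open>Constants of \<open>k\<close> inside k[V] become scalars of \<open>L\<close>
        in the tensor product.\<close>
      then have "q (iV a) = scalar F (h c)"
        using tensor_product_balanced[OF tensor_V V.ring_axioms L.ring_axioms] by (simp add: scalar)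
      then show ?thesis using c by (auto intro: generate_ring.incl)
    qed (auto intro: generate_ring.incl)
  next
    case (a_inv a)
    then have "a \<in> carrier V" using S(3) by simp
    then show ?case using a_inv subringE(5)[OF G] by simp
  next
    case (eng_add a b)
    then have "a \<in> carrier V" "b \<in> carrier V" using S(3) by simp_all
    then show ?case using eng_add subringE(7)[OF G] by simp
  next
    case (eng_mult a b)
    then have "a \<in> carrier V" "b \<in> carrier V" using S(3) by simp_all
    then show ?case using eng_mult subringE(6)[OF G] by simp
  qed
  then have GV: "q (iV a) \<in> ?G" if "a \<in> carrier V" for a using that S(3) by simp
  have "q x \<in> ?G" if "x \<in> carrier VL" for x
    using tensor_V that
  proof (induction rule: tensor_product_induct)
    case (pure a c)
    have "q (s c) \<in> ?G" using pure(2) by (intro generate_ring.incl) (auto simp: scalar)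
    then show ?case using GV[OF pure(1)] subringE(6)[OF G] pure by simp
  next
    case zero
    show ?case using subringE(2)[OF G] by simp
  next
    case (diff x y)
    then show ?case using subringE(5)[OF G, of "q y"] subringE(7)[OF G, of "q x" "\<ominus>\<^bsub>F\<^esub> q y"]
      by (simp add: a_minus_def)
  qed
  then have "?G = carrier F"
    using F.generate_ring_incl[OF sub] q_surj by auto
  moreover have "finite ?T" "?T \<subseteq> carrier F" using S sub by auto
  ultimately have fg: "\<exists>T. finite T \<and> T \<subseteq> carrier F \<and> generate_ring F (scalar F ` carrier L \<union> T) = carrier F"
    by blast
  have "scalar F \<in> bidifferential_hom L F"
    unfolding scalar using coset_hom_subvariety[OF bidifferential_VL I_ideal] homs(5)
    by (auto simp: bidifferential_hom_def intro: ring_hom_trans)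
  then show ?thesis
    unfolding irreducible_B_variety_def B_variety_def
    using bidifferential_L localization.F fg irreducible_spec_domain reduced_ring_domain by blast
qed

lemma B_locally_closed_fibre_iff:
  assumes "B_locally_closed k W"
  shows "B_locally_closed k V \<longleftrightarrow> B_locally_closed L F"
proof -
  obtain c where "c \<in> bidifferential_core W" "c \<noteq> \<zero>\<^bsub>W\<^esub>"
    using assms by (auto simp: B_locally_closed_iff)
  from localization.bidifferential_core_localization[OF this] show ?thesis
    using irreducible_V irreducible_fibre by (simp add: B_locally_closed_iff)
qed

end

theorem proposition4p7:
  fixes k :: "'k biring" and L :: "'l biring"
    and V :: "('k, 'x) bvariety" and W :: "('k, 'y) bvariety"
    and VL :: "('l, 's) bvariety" and WL :: "('l, 't) bvariety"
    and \<phi> :: "'y \<Rightarrow> 'x" and \<iota> :: "'y \<Rightarrow> 'l"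
    and iV :: "'x \<Rightarrow> 's" and iW :: "'y \<Rightarrow> 't"
    and \<phi>L :: "'t \<Rightarrow> 's" and \<alpha> :: "'t \<Rightarrow> 'l"
  assumes "bidifferential_field k" and "characteristic_zero k"
    and "irreducible_B_variety k V" and "irreducible_B_variety k W"
    and "B_morphism k V W \<phi>" and "dominant V W \<phi>"
    and "B_locally_closed k W"
    and "is_function_field W L \<iota>"
    and "generic_B_fibre k V W \<phi> L (\<iota> \<circ> scalar W) VL iV WL iW \<phi>L \<alpha>"
    and "field_of_point k W L (\<iota> \<circ> scalar W) iW \<alpha> = carrier L"
  shows "B_locally_closed k V \<longleftrightarrow>
         B_locally_closed L (subvariety VL (fibre VL WL \<phi>L (a_kernel WL L \<alpha>)))"
proof (rule generic_fibre.B_locally_closed_fibre_iff)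
  show "generic_fibre k V W \<phi> L (\<iota> \<circ> scalar W) VL iV WL iW \<phi>L \<alpha>"
    using assms by (intro generic_fibre.intro)
  show "B_locally_closed k W" by fact
qed

end
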